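(* Let $\mathcal{H}$ be the contact distribution on $S^7\subset\mathbb{R}^8$, $\mathcal H=\mathrm{span}\{X_2,\ldots,X_7\}$, and let $\langle\cdot,\cdot\rangle_{sR}$ be the restriction of the usual Riemannian metric of $\mathbb{R}^8$ to $\mathcal{H}$. Then the intrinsic sub-Laplacian of $(S^7,\mathcal{H},\langle\cdot,\cdot\rangle_{sR})$ is given by the sum of squares $$\Delta_{sR}=\sum_{a=2}^7X_a^2.$$
   Context: On $S^7\subset\mathbb{R}^8$ with coordinates $x=(x_0,\ldots,x_7)$, consider the vector fields (orthonormal frame of $TS^7$), written as the coefficient vectors with respect to $(\partial_{x_0},\ldots,\partial_{x_7})$: $X_1=(-x_1,x_0,-x_3,x_2,-x_5,x_4,-x_7,x_6)$, $X_2=(-x_2,x_3,x_0,-x_1,-x_6,x_7,x_4,-x_5)$, $X_3=(-x_3,-x_2,x_1,x_0,x_7,x_6,-x_5,-x_4)$, $X_4=(-x_4,x_5,x_6,-x_7,x_0,-x_1,-x_2,x_3)$, $X_5=(-x_5,-x_4,-x_7,-x_6,x_1,x_0,x_3,x_2)$, $X_6=(-x_6,x_7,-x_4,x_5,x_2,-x_3,x_0,-x_1)$, $X_7=(-x_7,-x_6,x_5,x_4,-x_3,-x_2,x_1,x_0)$. The contact distribution is $\mathcal H=\ker\omega$, $\omega=\sum_{k=0}^3(-x_{2k+1}dx_{2k}+x_{2k}dx_{2k+1})$, i.e. the orthogonal complement of $X_1$ in $TS^7$. Intrinsic sub-Laplacian: for a sub-Riemannian manifold $(M,\mathcal H,\langle\cdot,\cdot\rangle_{sR})$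 with regular distribution, the horizontal gradient $\nabla_{sR}f$ of a $C^2$ function $f$ is the horizontal vector field with $\langle\nabla_{sR}f(p),w\rangle_{sR}=d_pf(w)$ for all $w\in\mathcal H_p$; the divergence of a horizontal vector field $X$ is defined by $(\mathrm{div}_{sR}X)\,\mu_{sR}=L_X\mu_{sR}$, where $L_X$ is the Lie derivative and $\mu_{sR}$ is Popp's volume form; and $\Delta_{sR}f=\mathrm{div}_{sR}(\nabla_{sR}f)$. Popp's volume form for a step-two bracket generating regular distribution: the surjection $\mathcal H_p\otimes\mathcal H_p\to T_pM/\mathcal H_p$, $X\otimes Y\mapsto[X,Y]_p \bmod \mathcal H_p$, induces from the inner product of $\mathcal H_p\otimes\mathcal H_p$ an inner product on $T_pM/\mathcal H_p$ (by identifying the quotient with the orthogonal complement of the kernel). Together with $\langle\cdot,\cdot\rangle_{sR}$ this gives an inner product on $\mathcal H_p\oplus T_pM/\mathcal H_p$, hence a volume element on it (determined up to sign/orientation), which is transported to $T_pM$ through the canonical isomorphism $\bigwedge^n T_p^*M\cong\bigwedge^n(\mathcal H_p\oplus T_pM/\mathcal H_p)^*$, $n=\dim M$. *)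

theory Defs
  imports "HOL-Analysis.Analysis" "HOL-Library.Extended_Nat"
begin

section \<open>Calculus on submanifolds of a Euclidean space\<close>

primrec Ck_on :: "nat \<Rightarrow> 'a::euclidean_space set \<Rightarrow> ('a \<Rightarrow> 'b::real_normed_vector) \<Rightarrow> bool" where
  "Ck_on 0 U f \<longleftrightarrow> continuous_on U f"
| "Ck_on (Suc k) U f \<longleftrightarrow>
     f differentiable_on U \<and> (\<forall>v. Ck_on k U (\<lambda>x. frechet_derivative f (at x) v))"

text \<open>Only the values of \<open>f\<close> on \<open>M\<close> matter; \<open>k = \<infinity>\<close> is smoothness.\<close>

definition Ck_manifold :: "enat \<Rightarrow> 'a::euclidean_space set \<Rightarrow> ('a \<Rightarrow> 'b::real_normed_vector) \<Rightarrow> bool" where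
  "Ck_manifold k M f \<longleftrightarrow>
     (\<forall>p\<in>M. \<exists>U g. open U \<and> p \<in> U \<and> (\<forall>j. enat j \<le> k \<longrightarrow> Ck_on j U g) \<and> (\<forall>x\<in>U \<inter> M. g x = f x))"

definition tangent_space :: "'a::euclidean_space set \<Rightarrow> 'a \<Rightarrow> 'a set" where
  "tangent_space M p =
     {v. \<exists>c e. e > 0 \<and> (\<forall>t. \<bar>t\<bar> < e \<longrightarrow> c t \<in> M) \<and> c 0 = p \<and> (c has_vector_derivative v) (at (0::real))}"

text \<open>The differential \<open>d\<^sub>p f (v)\<close>. A derivative within \<open>M\<close> is not unique, but any two of them agree
  on tangent vectors, and only tangent vectors are ever inserted for \<open>v\<close>.\<close>

definition mdiff :: "'a::euclidean_space set \<Rightarrow> ('a \<Rightarrow> 'b::real_normed_vector) \<Rightarrow> 'a \<Rightarrow> 'a \<Rightarrow> 'b" where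
  "mdiff M f p v = frechet_derivative f (at p within M) v"

definition vf_apply :: "'a::euclidean_space set \<Rightarrow> ('a \<Rightarrow> 'a) \<Rightarrow> ('a \<Rightarrow> 'b::real_normed_vector) \<Rightarrow> 'a \<Rightarrow> 'b" where
  "vf_apply M X f = (\<lambda>p. mdiff M f p (X p))"

definition smooth_vf :: "'a::euclidean_space set \<Rightarrow> ('a \<Rightarrow> 'a) \<Rightarrow> bool" where
  "smooth_vf M X \<longleftrightarrow> Ck_manifold \<infinity> M X \<and> (\<forall>p\<in>M. X p \<in> tangent_space M p)"

definition lie_bracket :: "'a::euclidean_space set \<Rightarrow> ('a \<Rightarrow> 'a) \<Rightarrow> ('a \<Rightarrow> 'a) \<Rightarrow> 'a \<Rightarrow> 'a" where
  "lie_bracket M X Y = (\<lambda>p. vf_apply M X Y p - vf_apply M Y X p)"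

text \<open>Forms of degree \<open>CARD('k)\<close>; values on non-tangent arguments are irrelevant.\<close>

definition smooth_form :: "'a::euclidean_space set \<Rightarrow> ('a \<Rightarrow> ('k::finite \<Rightarrow> 'a) \<Rightarrow> real) \<Rightarrow> bool" where
  "smooth_form M \<mu> \<longleftrightarrow>
     (\<forall>p\<in>M. \<forall>e. (\<forall>i. e i \<in> tangent_space M p) \<longrightarrow>
        (\<forall>i. \<forall>u\<in>tangent_space M p. \<forall>w\<in>tangent_space M p. \<forall>a b.
           \<mu> p (e(i := a *\<^sub>R u + b *\<^sub>R w)) = a * \<mu> p (e(i := u)) + b * \<mu> p (e(i := w))) \<and>
        (\<forall>i j. i \<noteq> j \<and> e i = e j \<longrightarrow> \<mu> p e = 0)) \<and>
     (\<forall>V. (\<forall>i. smooth_vf M (V i)) \<longrightarrow> Ck_manifold \<infinity> M (\<lambda>p. \<mu> p (\<lambda>i. V i p)))"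

text \<open>The Lie derivative of a form, evaluated on vector fields:
  \<open>(L\<^sub>X \<mu>)(V\<^sub>1,\<dots>,V\<^sub>n) = X (\<mu>(V\<^sub>1,\<dots>,V\<^sub>n)) - \<Sum>\<^sub>i \<mu>(V\<^sub>1,\<dots>,[X,V\<^sub>i],\<dots>,V\<^sub>n)\<close>.\<close>

definition lie_derivative ::
  "'a::euclidean_space set \<Rightarrow> ('a \<Rightarrow> 'a) \<Rightarrow> ('a \<Rightarrow> ('k::finite \<Rightarrow> 'a) \<Rightarrow> real) \<Rightarrow> ('k \<Rightarrow> 'a \<Rightarrow> 'a) \<Rightarrow> 'a \<Rightarrow> real" where
  "lie_derivative M X \<mu> V p =
     vf_apply M X (\<lambda>q. \<mu> q (\<lambda>i. V i q)) p
     - (\<Sum>i\<in>UNIV. \<mu> p ((\<lambda>j. V j p)(i := lie_bracket M X (V i) p)))"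

definition divergence ::
  "'a::euclidean_space set \<Rightarrow> ('a \<Rightarrow> ('k::finite \<Rightarrow> 'a) \<Rightarrow> real) \<Rightarrow> ('a \<Rightarrow> 'a) \<Rightarrow> 'a \<Rightarrow> real" where
  "divergence M \<mu> X p =
     (THE c. \<forall>V. (\<forall>i. smooth_vf M (V i)) \<longrightarrow> lie_derivative M X \<mu> V p = c * \<mu> p (\<lambda>i. V i p))"


section \<open>Step-two sub-Riemannian structures with the metric restricted from \<open>\<real>\<^sup>n\<close>\<close>

definition horizontal_vf :: "'a::euclidean_space set \<Rightarrow> ('a \<Rightarrow> 'a set) \<Rightarrow> ('a \<Rightarrow> 'a) \<Rightarrow> bool" where
  "horizontal_vf M H X \<longleftrightarrow> smooth_vf M X \<and> (\<forall>p\<in>M. X p \<in> H p)"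

definition horizontal_gradient ::
  "'a::euclidean_space set \<Rightarrow> ('a \<Rightarrow> 'a set) \<Rightarrow> ('a \<Rightarrow> real) \<Rightarrow> 'a \<Rightarrow> 'a" where
  "horizontal_gradient M H f p = (THE v. v \<in> H p \<and> (\<forall>w\<in>H p. v \<bullet> w = mdiff M f p w))"

text \<open>\<open>\<real>\<^sup>n \<otimes> \<real>\<^sup>n\<close> is realised by matrices. The inner product of \<open>real ^ 'n ^ 'n\<close> is the tensor one:
  \<open>(x \<otimes> y) \<bullet> (x' \<otimes> y') = (x \<bullet> x') (y \<bullet> y')\<close>.\<close>

definition tensor :: "real ^ 'n \<Rightarrow> real ^ 'n \<Rightarrow> real ^ 'n ^ 'n" where
  "tensor x y = (\<chi> i j. x $ i * y $ j)"

definition tensor_square :: "(real ^ 'n) set \<Rightarrow> (real ^ 'n ^ 'n) set" where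
  "tensor_square S = span {tensor x y | x y. x \<in> S \<and> y \<in> S}"

text \<open>The linear map \<open>H\<^sub>p \<otimes> H\<^sub>p \<rightarrow> T\<^sub>pM / H\<^sub>p\<close>, \<open>X \<otimes> Y \<mapsto> [X,Y]\<^sub>p mod H\<^sub>p\<close>. Its value is
  a coset of \<open>H p\<close>, given as a set of tangent vectors.\<close>

definition bracket_class ::
  "(real ^ 'n) set \<Rightarrow> (real ^ 'n \<Rightarrow> (real ^ 'n) set) \<Rightarrow> real ^ 'n \<Rightarrow> real ^ 'n ^ 'n \<Rightarrow> (real ^ 'n) set" where
  "bracket_class M H p \<tau> =
     {v \<in> tangent_space M p. \<exists>(m::nat) X Y.
        (\<forall>i<m. horizontal_vf M H (X i) \<and> horizontal_vf M H (Y i)) \<and>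
        \<tau> = (\<Sum>i<m. tensor (X i p) (Y i p)) \<and>
        v - (\<Sum>i<m. lie_bracket M (X i) (Y i) p) \<in> H p}"

definition step_two_distribution :: "(real ^ 'n) set \<Rightarrow> (real ^ 'n \<Rightarrow> (real ^ 'n) set) \<Rightarrow> bool" where
  "step_two_distribution M H \<longleftrightarrow>
     (\<exists>m. \<forall>p\<in>M. dim (H p) = m) \<and>
     (\<forall>p\<in>M. subspace (H p) \<and> H p \<subseteq> tangent_space M p \<and>
        (\<forall>h\<in>H p. \<exists>X. horizontal_vf M H X \<and> X p = h) \<and>
        (\<forall>v\<in>tangent_space M p. \<exists>\<tau>\<in>tensor_square (H p). v \<in> bracket_class M H p \<tau>))"

definition bracket_kernel ::
  "(real ^ 'n) set \<Rightarrow> (real ^ 'n \<Rightarrow> (real ^ 'n) set) \<Rightarrow> real ^ 'n \<Rightarrow> (real ^ 'n ^ 'n) set" where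
  "bracket_kernel M H p = {\<tau> \<in> tensor_square (H p). bracket_class M H p \<tau> = H p}"

text \<open>The element of the orthogonal complement of the kernel which is identified with the class of
  \<open>v\<close> in \<open>T\<^sub>pM / H\<^sub>p\<close>.\<close>

definition quotient_lift ::
  "(real ^ 'n) set \<Rightarrow> (real ^ 'n \<Rightarrow> (real ^ 'n) set) \<Rightarrow> real ^ 'n \<Rightarrow> real ^ 'n \<Rightarrow> real ^ 'n ^ 'n" where
  "quotient_lift M H p v =
     (THE \<tau>. \<tau> \<in> tensor_square (H p) \<and> (\<forall>\<kappa>\<in>bracket_kernel M H p. \<tau> \<bullet> \<kappa> = 0) \<and>
        v \<in> bracket_class M H p \<tau>)"

definition quotient_inner ::
  "(real ^ 'n) set \<Rightarrow> (real ^ 'n \<Rightarrow> (real ^ 'n) set) \<Rightarrow> real ^ 'n \<Rightarrow> real ^ 'n \<Rightarrow> real ^ 'n \<Rightarrow> real" where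
  "quotient_inner M H p v w = quotient_lift M H p v \<bullet> quotient_lift M H p w"

definition splitting ::
  "(real ^ 'n) set \<Rightarrow> (real ^ 'n \<Rightarrow> (real ^ 'n) set) \<Rightarrow> real ^ 'n \<Rightarrow> (real ^ 'n \<Rightarrow> real ^ 'n) \<Rightarrow> bool" where
  "splitting M H p P \<longleftrightarrow> linear P \<and> (\<forall>v\<in>tangent_space M p. P v \<in> H p) \<and> (\<forall>h\<in>H p. P h = h)"

text \<open>The inner product of \<open>H\<^sub>p \<oplus> T\<^sub>pM / H\<^sub>p\<close>, pulled back to \<open>T\<^sub>pM\<close> by \<open>v \<mapsto> (P v, v mod H\<^sub>p)\<close>.\<close>

definition split_inner ::
  "(real ^ 'n) set \<Rightarrow> (real ^ 'n \<Rightarrow> (real ^ 'n) set) \<Rightarrow> (real ^ 'n \<Rightarrow> real ^ 'n) \<Rightarrow>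
     real ^ 'n \<Rightarrow> real ^ 'n \<Rightarrow> real ^ 'n \<Rightarrow> real" where
  "split_inner M H P p v w = P v \<bullet> P w + quotient_inner M H p v w"

text \<open>Popp's volume form. The isomorphism \<open>v \<mapsto> (P v, v mod H\<^sub>p)\<close> depends on \<open>P\<close>, but the isomorphism
  of top exterior powers it induces is the canonical one and does not. A volume element of an inner
  product space has the values \<open>1\<close> and \<open>-1\<close> on orthonormal bases, so on a connected manifold there
  are at most two Popp forms, which differ by a sign.\<close>

definition popp_volume_form ::
  "(real ^ 'n) set \<Rightarrow> (real ^ 'n \<Rightarrow> (real ^ 'n) set) \<Rightarrow> (real ^ 'n \<Rightarrow> ('k::finite \<Rightarrow> real ^ 'n) \<Rightarrow> real) \<Rightarrow> bool" where
  "popp_volume_form M H \<mu> \<longleftrightarrow>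
     step_two_distribution M H \<and> smooth_form M \<mu> \<and>
     (\<forall>p\<in>M. dim (tangent_space M p) = CARD('k) \<and>
        (\<forall>P e. splitting M H p P \<and> (\<forall>i. e i \<in> tangent_space M p) \<and>
           (\<forall>i j. split_inner M H P p (e i) (e j) = (if i = j then 1 else 0)) \<longrightarrow> \<bar>\<mu> p e\<bar> = 1))"

definition sub_laplacian ::
  "(real ^ 'n) set \<Rightarrow> (real ^ 'n \<Rightarrow> (real ^ 'n) set) \<Rightarrow> (real ^ 'n \<Rightarrow> ('k::finite \<Rightarrow> real ^ 'n) \<Rightarrow> real) \<Rightarrow>
     (real ^ 'n \<Rightarrow> real) \<Rightarrow> real ^ 'n \<Rightarrow> real" where
  "sub_laplacian M H \<mu> f = divergence M \<mu> (horizontal_gradient M H f)"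


section \<open>The contact distribution on the seven-sphere\<close>

text \<open>The coordinates \<open>x\<^sub>0, \<dots>, x\<^sub>7\<close> are \<open>x $ 0, \<dots>, x $ 7\<close> with indices in the type \<open>8\<close>. The library's
  \<open>vector\<close> starts at index 1, hence the separate constructor.\<close>

definition vec8 :: "real \<Rightarrow> real \<Rightarrow> real \<Rightarrow> real \<Rightarrow> real \<Rightarrow> real \<Rightarrow> real \<Rightarrow> real \<Rightarrow> real ^ 8" where
  "vec8 a0 a1 a2 a3 a4 a5 a6 a7 =
     (\<chi> i. if i = 0 then a0 else if i = 1 then a1 else if i = 2 then a2 else if i = 3 then a3
           else if i = 4 then a4 else if i = 5 then a5 else if i = 6 then a6 else a7)"

abbreviation S7 :: "(real ^ 8) set" where
  "S7 \<equiv> sphere 0 1"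

definition S7_frame :: "nat \<Rightarrow> real ^ 8 \<Rightarrow> real ^ 8" where
  "S7_frame a x =
     (if a = 1 then vec8 (- x$1) (x$0) (- x$3) (x$2) (- x$5) (x$4) (- x$7) (x$6)
      else if a = 2 then vec8 (- x$2) (x$3) (x$0) (- x$1) (- x$6) (x$7) (x$4) (- x$5)
      else if a = 3 then vec8 (- x$3) (- x$2) (x$1) (x$0) (x$7) (x$6) (- x$5) (- x$4)
      else if a = 4 then vec8 (- x$4) (x$5) (x$6) (- x$7) (x$0) (- x$1) (- x$2) (x$3)
      else if a = 5 then vec8 (- x$5) (- x$4) (- x$7) (- x$6) (x$1) (x$0) (x$3) (x$2)
      else if a = 6 then vec8 (- x$6) (x$7) (- x$4) (x$5) (x$2) (- x$3) (x$0) (- x$1)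
      else if a = 7 then vec8 (- x$7) (- x$6) (x$5) (x$4) (- x$3) (- x$2) (x$1) (x$0)
      else 0)"

definition contact_form :: "real ^ 8 \<Rightarrow> real ^ 8 \<Rightarrow> real" where
  "contact_form x v =
     (\<Sum>k = 0..(3::nat). - x $ of_nat (2 * k + 1) * v $ of_nat (2 * k) + x $ of_nat (2 * k) * v $ of_nat (2 * k + 1))"

definition contact_distribution :: "real ^ 8 \<Rightarrow> (real ^ 8) set" where
  "contact_distribution p = {v \<in> tangent_space S7 p. contact_form p v = 0}"

lemma UNIV_8: "(UNIV :: 8 set) = {0, 1, 2, 3, 4, 5, 6, 7}"
proof -
  have "card {0, 1, 2, 3, 4, 5, 6, 7 :: 8} = card (UNIV :: 8 set)" by simp
  then show ?thesis by (metis card_subset_eq finite subset_UNIV)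
qed

lemma vec8_nth:
  "vec8 a0 a1 a2 a3 a4 a5 a6 a7 $ 0 = a0" "vec8 a0 a1 a2 a3 a4 a5 a6 a7 $ 1 = a1"
  "vec8 a0 a1 a2 a3 a4 a5 a6 a7 $ 2 = a2" "vec8 a0 a1 a2 a3 a4 a5 a6 a7 $ 3 = a3"
  "vec8 a0 a1 a2 a3 a4 a5 a6 a7 $ 4 = a4" "vec8 a0 a1 a2 a3 a4 a5 a6 a7 $ 5 = a5"
  "vec8 a0 a1 a2 a3 a4 a5 a6 a7 $ 6 = a6" "vec8 a0 a1 a2 a3 a4 a5 a6 a7 $ 7 = a7"
  by (simp_all add: vec8_def)

lemma inner_8:
  fixes x y :: "real ^ 8"
  shows "x \<bullet> y = x$0 * y$0 + x$1 * y$1 + x$2 * y$2 + x$3 * y$3 + x$4 * y$4 + x$5 * y$5 + x$6 * y$6 + x$7 * y$7"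
  unfolding inner_vec_def UNIV_8 by simp

lemma tangent_space_S7:
  assumes "p \<in> S7"
  shows "tangent_space S7 p = {v. p \<bullet> v = 0}"
proof (intro equalityI subsetI)
  fix v assume "v \<in> tangent_space S7 p"
  then obtain c e where e: "e > 0" "\<And>t. \<bar>t\<bar> < e \<Longrightarrow> c t \<in> S7" and c: "c 0 = p"
    and d: "(c has_vector_derivative v) (at (0::real))"
    unfolding tangent_space_def by blast
  have "((\<lambda>t. c t \<bullet> c t) has_derivative (\<lambda>h. c 0 \<bullet> (h *\<^sub>R v) + (h *\<^sub>R v) \<bullet> c 0)) (at 0)"
    using d unfolding has_vector_derivative_def by (rule has_derivative_inner[OF _ d[unfolded has_vector_derivative_def]])
  moreover have "((\<lambda>t. c t \<bullet> c t) has_derivative (\<lambda>h. 0)) (at 0)"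
  proof (rule has_derivative_transform_within_open[of "\<lambda>_. 1" _ _ _ "{-e<..<e}"])
    fix t assume "t \<in> {-e<..<e}"
    then have "c t \<in> S7" by (intro e) auto
    then show "1 = c t \<bullet> c t" by (simp add: norm_eq_1)
  qed (use e in auto)
  ultimately have "(\<lambda>h. c 0 \<bullet> (h *\<^sub>R v) + (h *\<^sub>R v) \<bullet> c 0) = (\<lambda>h. 0)"
    by (rule has_derivative_unique)
  from fun_cong[OF this, of 1] show "v \<in> {v. p \<bullet> v = 0}" by (simp add: c inner_commute)
next
  fix v assume "v \<in> {v. p \<bullet> v = 0}"
  then have pv: "p \<bullet> v = 0" by simp
  have pp: "p \<bullet> p = 1" using assms by (simp add: norm_eq_1)
  define c where "c t = (1 / sqrt (1 + t\<^sup>2 * (v \<bullet> v))) *\<^sub>R (p + t *\<^sub>R v)" for t :: real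
  have pos: "0 < 1 + t\<^sup>2 * (v \<bullet> v)" for t :: real by (simp add: add_pos_nonneg)
  have "c t \<in> S7" for t
  proof -
    have "c t \<bullet> c t = 1"
      using pos[of t] pv by (simp add: c_def inner_add inner_commute pp power2_eq_square)
    then show ?thesis by (simp add: norm_eq_1)
  qed
  moreover have "c 0 = p" by (simp add: c_def)
  moreover have "(c has_vector_derivative v) (at 0)"
  proof -
    have "((\<lambda>t. 1 / sqrt (1 + t\<^sup>2 * (v \<bullet> v))) has_vector_derivative 0) (at 0)"
      unfolding has_real_derivative_iff_has_vector_derivative[symmetric]
      by (auto intro!: derivative_eq_intros)
    moreover have "((\<lambda>t. p + t *\<^sub>R v) has_vector_derivative v) (at 0)"
      by (auto intro!: derivative_eq_intros)
    ultimately show ?thesis unfolding c_def by (auto intro!: derivative_eq_intros)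
  qed
  ultimately show "v \<in> tangent_space S7 p"
    unfolding tangent_space_def by (auto intro!: exI[of _ c] exI[of _ "1::real"])
qed

lemma contact_form_eq: "contact_form x v = S7_frame 1 x \<bullet> v"
proof -
  have "{0..3::nat} = {0, 1, 2, 3}" by auto
  then show ?thesis by (simp add: contact_form_def S7_frame_def inner_8 vec8_nth)
qed

lemma S7_frame_orthonormal:
  assumes "x \<in> S7" "a \<in> {1..7}" "b \<in> {1..7}"
  shows "S7_frame a x \<bullet> S7_frame b x = (if a = b then 1 else 0)" "x \<bullet> S7_frame a x = 0"
proof -
  have xx: "x \<bullet> x = 1" using assms(1) by (simp add: norm_eq_1)
  have ab: "a \<in> {1,2,3,4,5,6,7}" "b \<in> {1,2,3,4,5,6,7}" using assms(2,3) by auto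
  show "x \<bullet> S7_frame a x = 0"
    using ab(1) by (elim insertE emptyE; simp add: S7_frame_def inner_8 vec8_nth)
  show "S7_frame a x \<bullet> S7_frame b x = (if a = b then 1 else 0)"
    using ab xx by (elim insertE emptyE; simp add: S7_frame_def inner_8 vec8_nth)
qed

lemma vec_eq_8:
  fixes x y :: "real ^ 8"
  shows "x = y \<longleftrightarrow> x$0 = y$0 \<and> x$1 = y$1 \<and> x$2 = y$2 \<and> x$3 = y$3 \<and> x$4 = y$4 \<and> x$5 = y$5 \<and> x$6 = y$6 \<and> x$7 = y$7"
proof -
  have "(\<forall>i. x$i = y$i) \<longleftrightarrow> (\<forall>i\<in>UNIV. x$i = y$i)" by simp
  then show ?thesis unfolding vec_eq_iff UNIV_8 by simp
qed

lemma S7_frame_expansion: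
  assumes "x \<in> S7"
  shows "v = (x \<bullet> v) *\<^sub>R x + (\<Sum>a = 1..7. (S7_frame a x \<bullet> v) *\<^sub>R S7_frame a x)"
proof -
  have xx: "x \<bullet> x = 1" using assms by (simp add: norm_eq_1)
  have "{1..7::nat} = {1,2,3,4,5,6,7}" by auto
  then have "(x \<bullet> x) *\<^sub>R v = (x \<bullet> v) *\<^sub>R x + (\<Sum>a = 1..7. (S7_frame a x \<bullet> v) *\<^sub>R S7_frame a x)"
    unfolding vec_eq_8
    by (simp add: S7_frame_def inner_8 vec8_nth) (auto simp: algebra_simps)
  then show ?thesis by (simp add: xx)
qed

lemma contact_distribution_eq_span:
  assumes "x \<in> S7"
  shows "contact_distribution x = span ((\<lambda>a. S7_frame a x) ` {2..7})"
proof (intro equalityI subsetI)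
  fix v assume "v \<in> contact_distribution x"
  then have v: "x \<bullet> v = 0" "S7_frame 1 x \<bullet> v = 0"
    using assms by (auto simp: contact_distribution_def tangent_space_S7 contact_form_eq)
  have "{1..7::nat} = insert 1 {2..7}" by auto
  then have "v = (\<Sum>a = 2..7. (S7_frame a x \<bullet> v) *\<^sub>R S7_frame a x)"
    using S7_frame_expansion[OF assms, of v] v by simp
  also have "\<dots> \<in> span ((\<lambda>a. S7_frame a x) ` {2..7})"
    by (intro span_sum span_scale span_base) auto
  finally show "v \<in> span ((\<lambda>a. S7_frame a x) ` {2..7})" .
next
  fix v assume "v \<in> span ((\<lambda>a. S7_frame a x) ` {2..7})"
  moreover have "subspace {v. x \<bullet> v = 0 \<and> S7_frame 1 x \<bullet> v = 0}"
    by (auto simp: subspace_def inner_add_right)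
  moreover have "(\<lambda>a. S7_frame a x) ` {2..7} \<subseteq> {v. x \<bullet> v = 0 \<and> S7_frame 1 x \<bullet> v = 0}"
    using S7_frame_orthonormal[OF assms, of _ 1] S7_frame_orthonormal[OF assms, of 1] by auto
  ultimately have "v \<in> {v. x \<bullet> v = 0 \<and> S7_frame 1 x \<bullet> v = 0}"
    using span_minimal by blast
  then show "v \<in> contact_distribution x"
    using assms by (auto simp: contact_distribution_def tangent_space_S7 contact_form_eq)
qed

end

theory Submission
  imports Defs
begin

text \<open>
  Write \<open>J\<close> for the linear map \<open>S7_frame 1\<close>. Differentiating \<open>J q \<bullet> Y q = 0\<close> along a horizontal field
  \<open>X\<close> gives \<open>X\<^sub>1 \<bullet> [X, Y] = - 2 J X \<bullet> Y\<close>, so the bracket map is represented by a tensor of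
  squared norm \<open>24\<close> at every point, and the quotient inner product is
  \<open>(X\<^sub>1 \<bullet> v) (X\<^sub>1 \<bullet> w) / 24\<close>. Hence a Popp form has constant absolute value on the frame
  \<open>X\<^sub>1, \<dots>, X\<^sub>7\<close>. Its Lie derivative along \<open>\<Sum>\<^sub>a u\<^sub>a X\<^sub>a\<close> is therefore the form times
  \<open>\<Sum>\<^sub>a X\<^sub>a u\<^sub>a\<close>: the remaining terms vanish because the fields \<open>X\<^sub>a\<close> are linear and skew.
  The horizontal gradient is the case \<open>u\<^sub>1 = 0\<close>, \<open>u\<^sub>a = X\<^sub>a f\<close>.
\<close>

section \<open>Alternating forms and determinants\<close>

text \<open>On a tangent space the value of the form is \<open>det C * g\<close>, where
  \<open>C\<close> holds the frame coordinates of the arguments and \<open>g\<close> is the value on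
  the frame. In the Lie derivative along \<open>Y\<close> the derivatives of the arguments cancel
  against the brackets, and what replaces a row of \<open>C\<close> is a row of
  \<open>C ** M\<close>, with \<open>M\<close> depending only on \<open>Y\<close> and the point. The
  divergence is then \<open>trace M\<close>, and linearity and skewness of the frame serve to
  compute this trace. A Popp form is pinned down only up to a sign at each point, but
  differentiating \<open>g\<^sup>2 = c\<close> already gives \<open>g' = 0\<close> on tangent
  vectors. A function of class C^2 has a gradient of class C^1 only, so the divergence formula asks
  just for derivatives of the coefficients at the point. Existence of a Popp form is a separate
  matter: the normalisation must hold for every splitting of the tangent space. A change of
  splitting alters one row of a matrix that is otherwise the identity, and only off the diagonal, so
  the determinant does not see it.\<close>

locale alternating_form =
  fixes T :: "'a::real_vector set" and \<omega> :: "('k::finite \<Rightarrow> 'a) \<Rightarrow> real"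
  assumes subspace: "subspace T"
    and multilinear: "\<And>e i u w a b. (\<And>i. e i \<in> T) \<Longrightarrow> u \<in> T \<Longrightarrow> w \<in> T \<Longrightarrow>
      \<omega> (e(i := a *\<^sub>R u + b *\<^sub>R w)) = a * \<omega> (e(i := u)) + b * \<omega> (e(i := w))"
    and alternating: "\<And>e i j. (\<And>i. e i \<in> T) \<Longrightarrow> i \<noteq> j \<Longrightarrow> e i = e j \<Longrightarrow> \<omega> e = 0"
begin

lemma form_add:
  assumes "\<And>i. e i \<in> T" "u \<in> T" "w \<in> T"
  shows "\<omega> (e(i := u + w)) = \<omega> (e(i := u)) + \<omega> (e(i := w))"
  using multilinear[OF assms, where i = i and a = 1 and b = 1] by simp

lemma form_scaleR:
  assumes "\<And>i. e i \<in> T" "u \<in> T"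
  shows "\<omega> (e(i := a *\<^sub>R u)) = a * \<omega> (e(i := u))"
  using multilinear[OF assms assms(2), where i = i and a = a and b = 0] by simp

lemma form_scaleR_family:
  assumes e: "\<And>i. e i \<in> T"
  shows "\<omega> (\<lambda>i. c i *\<^sub>R e i) = (\<Prod>i\<in>UNIV. c i) * \<omega> e"
proof -
  have "\<omega> (\<lambda>i. if i \<in> S then c i *\<^sub>R e i else e i) = (\<Prod>i\<in>S. c i) * \<omega> e" if "finite S" for S
    using that
  proof (induction S)
    case (insert k S)
    let ?e = "\<lambda>i. if i \<in> S then c i *\<^sub>R e i else e i"
    have "(\<lambda>i. if i \<in> insert k S then c i *\<^sub>R e i else e i) = ?e(k := c k *\<^sub>R e k)"
      by auto
    moreover have "?e(k := e k) = ?e"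
      using insert.hyps by auto
    moreover have "?e i \<in> T" for i
      using e subspace by (simp add: subspace_scale)
    ultimately show ?case
      using insert form_scaleR[of ?e "e k" k "c k"] e by simp
  qed simp
  from this[of UNIV] show ?thesis by simp
qed

text \<open>Polarisation: the value with \<open>e m + e n\<close> in both slots vanishes, and
  expanding it leaves the two mixed terms.\<close>

lemma form_swap:
  assumes e: "\<And>i. e i \<in> T" and "m \<noteq> n"
  shows "\<omega> (\<lambda>i. e (Transposition.transpose m n i)) = - \<omega> e"
proof -
  have 1: "(e(n := u))(m := w) = (e(m := w))(n := u)" for u w
    using assms(2) by auto
  have T: "(e(i := u)) j \<in> T" if "u \<in> T" for i j u
    using e that by simp
  have s: "e m + e n \<in> T"
    using e subspace by (simp add: subspace_add)
  have "\<omega> ((e(n := e m + e n))(m := e m + e n)) = 0"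
    by (rule alternating[of _ m n]) (use assms e s in auto)
  moreover have "\<omega> ((e(n := e m + e n))(m := e m + e n)) =
      \<omega> ((e(m := e m))(n := e m)) + \<omega> ((e(m := e m))(n := e n))
      + (\<omega> ((e(m := e n))(n := e m)) + \<omega> ((e(m := e n))(n := e n)))"
    using form_add[of "e(n := e m + e n)" "e m" "e n" m] form_add[of "e(m := e m)" "e m" "e n" n]
      form_add[of "e(m := e n)" "e m" "e n" n] T s e unfolding 1 by simp
  moreover have "\<omega> ((e(m := e m))(n := e m)) = 0" "\<omega> ((e(m := e n))(n := e n)) = 0"
    using assms e by (auto intro!: alternating[of _ m n])
  moreover have "(e(m := e n))(n := e m) = (\<lambda>i. e (Transposition.transpose m n i))"
    by (auto simp: Transposition.transpose_def)
  ultimately show ?thesis by simp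
qed

lemma form_eq_det:
  fixes A :: "real ^ 'k ^ 'k"
  assumes "\<And>i. e i \<in> T"
  shows "\<omega> (\<lambda>i. \<Sum>j\<in>UNIV. A $ i $ j *\<^sub>R e j) = det A * \<omega> e"
proof -
  \<comment> \<open>The family stays quantified because in the product case the hypothesis for
    \<open>A\<close> is applied to the family that \<open>B\<close> makes out of
    \<open>e\<close>.\<close>
  have "\<forall>e. (\<forall>i. e i \<in> T) \<longrightarrow> \<omega> (\<lambda>i. \<Sum>j\<in>UNIV. A $ i $ j *\<^sub>R e j) = det A * \<omega> e"
  proof (induction A rule: induct_matrix_elementary)
    case (1 A B)
    show ?case
    proof (intro allI impI)
      fix e :: "'k \<Rightarrow> 'a" assume e: "\<forall>i. e i \<in> T"
      let ?Be = "\<lambda>i. \<Sum>j\<in>UNIV. B $ i $ j *\<^sub>R e j"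
      have "(\<Sum>j\<in>UNIV. (A ** B) $ i $ j *\<^sub>R e j) = (\<Sum>k\<in>UNIV. A $ i $ k *\<^sub>R ?Be k)" for i
      proof -
        have "(\<Sum>j\<in>UNIV. (A ** B) $ i $ j *\<^sub>R e j)
            = (\<Sum>j\<in>UNIV. \<Sum>k\<in>UNIV. (A $ i $ k * B $ k $ j) *\<^sub>R e j)"
          by (simp add: matrix_matrix_mult_def scaleR_sum_left)
        also have "\<dots> = (\<Sum>k\<in>UNIV. \<Sum>j\<in>UNIV. (A $ i $ k * B $ k $ j) *\<^sub>R e j)"
          by (rule sum.swap)
        finally show ?thesis by (simp add: scaleR_sum_right)
      qed
      moreover have "\<forall>i. ?Be i \<in> T"
        using e subspace by (auto intro!: subspace_sum subspace_scale)
      ultimately show "\<omega> (\<lambda>i. \<Sum>j\<in>UNIV. (A ** B) $ i $ j *\<^sub>R e j) = det (A ** B) * \<omega> e"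
        using 1 e by (simp add: det_mul)
    qed
  next
    case (2 A i)
    show ?case
    proof (intro allI impI)
      fix e :: "'k \<Rightarrow> 'a" assume e: "\<forall>i. e i \<in> T"
      let ?Ae = "\<lambda>i. \<Sum>j\<in>UNIV. A $ i $ j *\<^sub>R e j"
      have T: "?Ae i \<in> T" for i
        using e subspace by (auto intro!: subspace_sum subspace_scale)
      have "A $ i = 0"
        using 2 by (simp add: row_def vec_eq_iff)
      then have "?Ae = ?Ae(i := 0 *\<^sub>R e i)"
        by auto
      then have "\<omega> ?Ae = 0"
        using form_scaleR[of ?Ae "e i" i 0] T e by simp
      then show "\<omega> ?Ae = det A * \<omega> e"
        using 2 by (simp add: det_zero_row)
    qed
  next
    case (3 A)
    have "(\<Sum>j\<in>UNIV. A $ i $ j *\<^sub>R e j) = A $ i $ i *\<^sub>R e i" for i and e :: "'k \<Rightarrow> 'a"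
      using 3 by (subst sum.remove[of _ i]) (auto intro!: sum.neutral)
    then show ?case
      using 3 form_scaleR_family[of _ "\<lambda>i. A $ i $ i"] by (simp add: det_diagonal)
  next
    case (4 m n)
    let ?\<tau> = "Transposition.transpose m n"
    let ?A = "(\<chi> i j. mat 1 $ i $ ?\<tau> j) :: real^'k^'k"
    have "(\<Sum>j\<in>UNIV. ?A $ i $ j *\<^sub>R e j) = e (?\<tau> i)"
      for i and e :: "'k \<Rightarrow> 'a"
    proof -
      have "(\<Sum>j\<in>UNIV. ?A $ i $ j *\<^sub>R e j)
          = (\<Sum>j\<in>UNIV. if j = ?\<tau> i then e j else 0)"
        by (intro sum.cong) (auto simp: mat_def)
      then show ?thesis by simp
    qed
    moreover have "det ?A = - 1"
      using det_permute_columns[of ?\<tau> "mat 1 :: real^'k^'k"] 4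
      by (simp add: permutes_swap_id sign_swap_id)
    ultimately show ?case
      using form_swap 4 by simp
  next
    case (5 m n c)
    let ?A = "(\<chi> i j. if i = m \<and> j = n then c else of_bool (i = j)) :: real^'k^'k"
    have "?A = (\<chi> k. if k = m then row m (mat 1) + c *s row n (mat 1) else row k (mat 1))"
      using 5 by (auto simp: vec_eq_iff row_def mat_def)
    then have "det ?A = 1"
      using det_row_operation[OF 5, of "mat 1 :: real^'k^'k" c] by simp
    moreover have "(\<lambda>i. \<Sum>j\<in>UNIV. ?A $ i $ j *\<^sub>R e j) = e(m := e m + c *\<^sub>R e n)" for e :: "'k \<Rightarrow> 'a"
    proof
      fix i
      have "(\<Sum>j\<in>UNIV. ?A $ i $ j *\<^sub>R e j)
          = (\<Sum>j\<in>UNIV. (if j = i then e j else 0) + (if j = n then if i = m then c *\<^sub>R e j else 0 else 0))"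
        using 5 by (intro sum.cong) auto
      then show "(\<Sum>j\<in>UNIV. ?A $ i $ j *\<^sub>R e j) = (e(m := e m + c *\<^sub>R e n)) i"
        by (simp add: sum.distrib)
    qed
    moreover have "\<omega> (e(m := e m + c *\<^sub>R e n)) = \<omega> e" if "\<forall>i. e i \<in> T" for e
    proof -
      have "\<omega> (e(m := e n)) = 0"
        using that 5 by (intro alternating[of _ m n]) auto
      then show ?thesis
        using multilinear[where e = e and i = m and u = "e m" and w = "e n" and a = 1 and b = c] that by simp
    qed
    ultimately show ?case by simp
  qed
  with assms show ?thesis by blast
qed

end

section \<open>Determinants with one row replaced, and the derivative of a determinant\<close>

lemma det_replace_row_mat_1:
  fixes t :: "real ^ 'n"
  shows "det (\<chi> i. if i = k then t else axis i 1) = t $ k"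
proof -
  have "(\<Sum>i\<in>UNIV. t $ i *s row i (mat 1)) = t"
    by (simp add: vec_eq_iff row_def mat_def if_distrib cong: if_cong)
  moreover have "row i (mat 1) = (axis i 1 :: real ^ 'n)" for i
    by (simp add: vec_eq_iff row_def mat_def axis_def)
  ultimately show ?thesis
    using cramer_lemma_transpose[of k t "mat 1"] by (simp cong: if_cong)
qed

text \<open>Differentiate the Leibniz formula factor by factor: the terms in which the factor from
  row \<open>k\<close> is differentiated are the Leibniz expansion of the determinant with that row
  replaced.\<close>

lemma has_derivative_det:
  fixes A :: "'a::real_normed_vector \<Rightarrow> real ^ 'n ^ 'n"
  assumes "\<And>i j. ((\<lambda>x. A x $ i $ j) has_derivative (\<lambda>h. A' h $ i $ j)) (at x within S)"
  shows "((\<lambda>x. det (A x)) has_derivative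
    (\<lambda>h. \<Sum>k\<in>UNIV. det (\<chi> i. if i = k then A' h $ i else A x $ i))) (at x within S)"
proof -
  let ?P = "{p. p permutes (UNIV :: 'n set)}"
  have "((\<lambda>x. det (A x)) has_derivative (\<lambda>h. \<Sum>p\<in>?P. of_int (sign p) *
      (\<Sum>k\<in>UNIV. A' h $ k $ p k * (\<Prod>j\<in>UNIV - {k}. A x $ j $ p j)))) (at x within S)"
    unfolding det_def by (intro has_derivative_sum has_derivative_mult_right has_derivative_prod assms)
  moreover have "(\<Sum>p\<in>?P. of_int (sign p) *
      (\<Sum>k\<in>UNIV. A' h $ k $ p k * (\<Prod>j\<in>UNIV - {k}. A x $ j $ p j)))
    = (\<Sum>k\<in>UNIV. det (\<chi> i. if i = k then A' h $ i else A x $ i))" for h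
  proof -
    have "A' h $ k $ p k * (\<Prod>j\<in>UNIV - {k}. A x $ j $ p j)
      = (\<Prod>i\<in>UNIV. (\<chi> i. if i = k then A' h $ i else A x $ i) $ i $ p i)" for k p
      by (subst prod.remove[of _ k]) auto
    then show ?thesis
      unfolding det_def by (simp add: sum_distrib_left sum.swap[of _ ?P])
  qed
  ultimately show ?thesis by simp
qed

text \<open>Expanding by Leibniz, replacing each row in turn by the rows of \<open>B\<close> gives the same sum as
  replacing each column in turn; for columns in the range of \<open>C\<close> Cramer's lemma applies.\<close>

lemma sum_det_replace_rows:
  fixes C M :: "real ^ 'n ^ 'n"
  shows "(\<Sum>k\<in>UNIV. det (\<chi> i. if i = k then (C ** M) $ i else C $ i)) = trace M * det C"
proof -
  let ?P = "{p. p permutes (UNIV :: 'n set)}"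
  define B where "B = C ** M"
  have "(\<Sum>k\<in>UNIV. det (\<chi> i. if i = k then B $ i else C $ i))
      = (\<Sum>p\<in>?P. \<Sum>k\<in>UNIV. of_int (sign p) * (\<Prod>i\<in>UNIV. if i = k then B $ i $ p i else C $ i $ p i))"
    unfolding det_def by (subst sum.swap) (auto intro!: sum.cong prod.cong)
  also have "\<dots> = (\<Sum>p\<in>?P. \<Sum>l\<in>UNIV. of_int (sign p) *
      (\<Prod>i\<in>UNIV. if p i = l then B $ i $ p i else C $ i $ p i))"
  proof (rule sum.cong[OF refl])
    fix p assume "p \<in> ?P"
    then have bij: "bij p" and "inj p"
      by (auto simp: permutes_bij permutes_inj)
    then have "p i = p k \<longleftrightarrow> i = k" for i k
      by (auto dest: injD)
    then show "(\<Sum>k\<in>UNIV. of_int (sign p) * (\<Prod>i\<in>UNIV. if i = k then B $ i $ p i else C $ i $ p i))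
        = (\<Sum>l\<in>UNIV. of_int (sign p) * (\<Prod>i\<in>UNIV. if p i = l then B $ i $ p i else C $ i $ p i))"
      using sum.reindex_bij_betw[OF bij, of "\<lambda>l. of_int (sign p) *
        (\<Prod>i\<in>UNIV. if p i = l then B $ i $ p i else C $ i $ p i)"] by simp
  qed
  also have "\<dots> = (\<Sum>l\<in>UNIV. det (\<chi> i j. if j = l then B $ i $ j else C $ i $ j))"
    unfolding det_def by (subst sum.swap) (auto intro!: sum.cong prod.cong)
  also have "\<dots> = (\<Sum>l\<in>UNIV. M $ l $ l * det C)"
  proof (rule sum.cong[OF refl])
    fix l
    have "(\<chi> i j. if j = l then B $ i $ j else C $ i $ j)
        = (\<chi> i j. if j = l then (C *v column l M) $ i else C $ i $ j)"
      by (auto simp: vec_eq_iff B_def matrix_matrix_mult_def matrix_vector_mult_def column_def)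
    then show "det (\<chi> i j. if j = l then B $ i $ j else C $ i $ j) = M $ l $ l * det C"
      by (simp add: cramer_lemma column_def)
  qed
  finally show ?thesis
    by (simp only: B_def trace_def sum_distrib_right)
qed

lemma det_row_diff:
  fixes a b :: "'n::finite \<Rightarrow> real ^ 'n"
  shows "det (\<chi> i. if i = k then a i else c i) - det (\<chi> i. if i = k then b i else c i)
    = det (\<chi> i. if i = k then a i - b i else c i)"
  using det_row_add[of k "\<lambda>i. a i - b i" b c] by (simp cong: if_cong)

section \<open>Calculus on submanifolds\<close>

text \<open>A curve in \<open>M\<close> with velocity \<open>v\<close> turns any derivative within
  \<open>M\<close> into a derivative in one real variable, which is unique. This frees all later
  computations from the choice hidden in \<open>frechet_derivative\<close>.\<close>

lemma mdiff_eq: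
  assumes D: "(f has_derivative D) (at p within M)" and v: "v \<in> tangent_space M p"
  shows "mdiff M f p v = D v"
proof -
  obtain c e where e: "e > 0" "\<And>t. \<bar>t\<bar> < e \<Longrightarrow> c t \<in> M" "c 0 = p"
    and c: "(c has_vector_derivative v) (at (0::real))"
    using v unfolding tangent_space_def by blast
  have "((f \<circ> c) has_derivative (A \<circ> (\<lambda>h. h *\<^sub>R v))) (at 0)"
    if A: "(f has_derivative A) (at p within M)" for A
  proof -
    have "(c has_derivative (\<lambda>h. h *\<^sub>R v)) (at 0 within ball 0 e)"
      using c unfolding has_vector_derivative_def by (rule has_derivative_at_withinI)
    moreover have "(f has_derivative A) (at (c 0) within c ` ball 0 e)"
      using A e by (auto intro!: has_derivative_subset[where s = M])
    ultimately have "((f \<circ> c) has_derivative (A \<circ> (\<lambda>h. h *\<^sub>R v))) (at 0 within ball 0 e)"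
      by (rule diff_chain_within)
    then show ?thesis
      using e(1) at_within_open[of "0::real" "ball 0 e"] by simp
  qed
  moreover have "(f has_derivative frechet_derivative f (at p within M)) (at p within M)"
    using D frechet_derivative_works differentiableI by blast
  ultimately have "frechet_derivative f (at p within M) \<circ> (\<lambda>h. h *\<^sub>R v) = D \<circ> (\<lambda>h. h *\<^sub>R v)"
    using D has_derivative_unique by blast
  from fun_cong[OF this, of 1] show ?thesis by (simp add: mdiff_def)
qed

lemma tangent_derivative_unique:
  assumes "(f has_derivative D) (at p within M)" "(f has_derivative D') (at p within M)"
    "v \<in> tangent_space M p"
  shows "D v = D' v"
  using mdiff_eq[OF assms(1,3)] mdiff_eq[OF assms(2,3)] by simp

text \<open>Used with \<open>J\<close> the identity, where the constraint is tangency to the sphere,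
  and with \<open>J = S7_frame 1\<close>, where it is horizontality.\<close>

lemma orthogonal_field_derivative:
  assumes "p \<in> M" "v \<in> tangent_space M p" "bounded_linear J"
    and orth: "\<And>q. q \<in> M \<Longrightarrow> J q \<bullet> Y q = 0"
    and Y: "(Y has_derivative Y') (at p within M)"
  shows "J p \<bullet> Y' v = - (J v \<bullet> Y p)"
proof -
  have "(J has_derivative J) (at p within M)"
    using assms(3) by (rule bounded_linear_imp_has_derivative)
  then have "((\<lambda>q. J q \<bullet> Y q) has_derivative (\<lambda>h. J p \<bullet> Y' h + J h \<bullet> Y p)) (at p within M)"
    using Y by (rule has_derivative_inner)
  moreover have "((\<lambda>q. J q \<bullet> Y q) has_derivative (\<lambda>h. 0)) (at p within M)"
    using assms(1) orth by (rule has_derivative_transform) auto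
  ultimately have "J p \<bullet> Y' v + J v \<bullet> Y p = 0"
    using assms(2) by (rule tangent_derivative_unique)
  then show ?thesis by simp
qed

section \<open>Closure of C^k functions under linear and bilinear operations\<close>

lemma Ck_on_subset: "Ck_on k U f \<Longrightarrow> V \<subseteq> U \<Longrightarrow> Ck_on k V f"
  by (induction k arbitrary: f) (auto intro: continuous_on_subset differentiable_on_subset)

lemma Ck_on_Suc_imp: "Ck_on (Suc k) U f \<Longrightarrow> Ck_on k U f"
  by (induction k arbitrary: f) (simp_all add: differentiable_imp_continuous_on)

lemma Ck_on_SucI:
  assumes "open U" "\<And>x. x \<in> U \<Longrightarrow> (f has_derivative f' x) (at x)"
    and "\<And>v. Ck_on k U (\<lambda>x. frechet_derivative f (at x) v)"
  shows "Ck_on (Suc k) U f"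
  using assms by (auto simp: differentiable_on_eq_differentiable_at differentiable_def)

lemma Ck_on_Suc_has_derivative:
  assumes "Ck_on (Suc k) U f" "open U" "x \<in> U"
  shows "(f has_derivative frechet_derivative f (at x)) (at x)"
  using assms frechet_derivative_works
  by (auto simp: differentiable_on_eq_differentiable_at)

text \<open>The product and sum rules identify \<open>frechet_derivative\<close> only at points of
  \<open>U\<close>, so the inductions below must replace a function by one that agrees with it on
  \<open>U\<close>. On an open set this does not change derivatives of any order.\<close>

lemma Ck_on_cong:
  assumes "open U" "\<And>x. x \<in> U \<Longrightarrow> f x = g x"
  shows "Ck_on k U f \<longleftrightarrow> Ck_on k U g"
proof -
  have "Ck_on k U g" if "open U" "\<And>x. x \<in> U \<Longrightarrow> f x = g x" "Ck_on k U f" for f g :: "'a \<Rightarrow> 'b"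
    using that
  proof (induction k arbitrary: f g)
    case 0
    then show ?case by (simp cong: continuous_on_cong)
  next
    case (Suc k)
    have d: "(g has_derivative frechet_derivative f (at x)) (at x)" if "x \<in> U" for x
      using Ck_on_Suc_has_derivative[OF Suc.prems(3,1) that] Suc.prems(1,2) that
      by (auto intro: has_derivative_transform_within_open)
    then have "frechet_derivative f (at x) v = frechet_derivative g (at x) v" if "x \<in> U" for x v
      using that frechet_derivative_at by metis
    then have "Ck_on k U (\<lambda>x. frechet_derivative g (at x) v)" for v
      using Suc.IH[of "\<lambda>x. frechet_derivative f (at x) v" "\<lambda>x. frechet_derivative g (at x) v"] Suc.prems
      by simp
    with Suc.prems(1) d show ?case by (rule Ck_on_SucI)
  qed
  from this[of f g] this[of g f] assms show ?thesis by auto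
qed

lemma Ck_on_const: "open U \<Longrightarrow> Ck_on k U (\<lambda>_. c)"
  by (induction k arbitrary: c) simp_all

lemma Ck_on_bounded_linear:
  assumes "bounded_linear f" "open U"
  shows "Ck_on k U f"
proof (cases k)
  case 0
  then show ?thesis
    using assms by (simp add: linear_continuous_on)
next
  case (Suc n)
  have d: "(f has_derivative f) (at x)" for x
    using assms(1) by (rule bounded_linear_imp_has_derivative)
  have "(\<lambda>x. frechet_derivative f (at x) v) = (\<lambda>_. f v)" for v
    using frechet_derivative_at[OF d] by metis
  then show ?thesis
    unfolding Suc using assms(2) d Ck_on_const by (intro Ck_on_SucI) auto
qed

lemma Ck_on_add:
  assumes "open U" "Ck_on k U f" "Ck_on k U g"
  shows "Ck_on k U (\<lambda>x. f x + g x)"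
  using assms(2,3)
proof (induction k arbitrary: f g)
  case 0
  then show ?case by (simp add: continuous_on_add)
next
  case (Suc k)
  have d: "((\<lambda>x. f x + g x) has_derivative
      (\<lambda>v. frechet_derivative f (at x) v + frechet_derivative g (at x) v)) (at x)" if "x \<in> U" for x
    using Ck_on_Suc_has_derivative[OF Suc.prems(1) assms(1) that]
      Ck_on_Suc_has_derivative[OF Suc.prems(2) assms(1) that] by (rule has_derivative_add)
  have "Ck_on k U (\<lambda>x. frechet_derivative (\<lambda>x. f x + g x) (at x) v)
      \<longleftrightarrow> Ck_on k U (\<lambda>x. frechet_derivative f (at x) v + frechet_derivative g (at x) v)" for v
    using frechet_derivative_at[OF d, symmetric] by (intro Ck_on_cong assms(1)) simp
  with Suc show ?case
    by (intro Ck_on_SucI[OF assms(1) d]) simp_all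
qed

lemma (in bounded_bilinear) Ck_on:
  assumes "open U" "Ck_on k U f" "Ck_on k U g"
  shows "Ck_on k U (\<lambda>x. prod (f x) (g x))"
  using assms(2,3)
proof (induction k arbitrary: f g)
  case 0
  then show ?case by (simp add: continuous_on)
next
  case (Suc k)
  have d: "((\<lambda>x. prod (f x) (g x)) has_derivative
      (\<lambda>v. prod (f x) (frechet_derivative g (at x) v) + prod (frechet_derivative f (at x) v) (g x))) (at x)"
    if "x \<in> U" for x
    using Ck_on_Suc_has_derivative[OF Suc.prems(1) assms(1) that]
      Ck_on_Suc_has_derivative[OF Suc.prems(2) assms(1) that] by (rule FDERIV)
  have "Ck_on k U (\<lambda>x. frechet_derivative (\<lambda>x. prod (f x) (g x)) (at x) v) \<longleftrightarrow>
      Ck_on k U (\<lambda>x. prod (f x) (frechet_derivative g (at x) v) + prod (frechet_derivative f (at x) v) (g x))" for v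
    using frechet_derivative_at[OF d, symmetric] by (intro Ck_on_cong assms(1)) simp
  moreover have "Ck_on k U f" "Ck_on k U g"
    using Suc.prems by (blast intro: Ck_on_Suc_imp)+
  ultimately show ?case
    using Suc by (intro Ck_on_SucI[OF assms(1) d]) (auto intro!: Ck_on_add assms(1))
qed

lemma Ck_manifoldD:
  assumes "Ck_manifold k M f" "p \<in> M"
  shows "\<exists>U g. open U \<and> p \<in> U \<and> (\<forall>j. enat j \<le> k \<longrightarrow> Ck_on j U g) \<and> (\<forall>x\<in>U \<inter> M. g x = f x)"
  using assms unfolding Ck_manifold_def by (rule bspec)

lemma Ck_manifold_bounded_linear: "bounded_linear f \<Longrightarrow> Ck_manifold k M f"
  unfolding Ck_manifold_def by (blast intro: Ck_on_bounded_linear)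

lemma Ck_manifold_const: "Ck_manifold k M (\<lambda>_. c)"
  unfolding Ck_manifold_def by (blast intro: Ck_on_const)

lemma Ck_manifold_combine:
  fixes M :: "'a::euclidean_space set"
  assumes f: "Ck_manifold k M f" and g: "Ck_manifold k M g"
    and h: "\<And>j (U :: 'a set) f g. open U \<Longrightarrow> Ck_on j U f \<Longrightarrow> Ck_on j U g \<Longrightarrow> Ck_on j U (\<lambda>x. h (f x) (g x))"
  shows "Ck_manifold k M (\<lambda>x. h (f x) (g x))"
  unfolding Ck_manifold_def
proof
  fix p assume p: "p \<in> M"
  obtain U f' where f': "open U" "p \<in> U" "\<And>j. enat j \<le> k \<Longrightarrow> Ck_on j U f'" "\<And>x. x \<in> U \<inter> M \<Longrightarrow> f' x = f x"
    using Ck_manifoldD[OF f p] by auto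
  obtain V g' where g': "open V" "p \<in> V" "\<And>j. enat j \<le> k \<Longrightarrow> Ck_on j V g'" "\<And>x. x \<in> V \<inter> M \<Longrightarrow> g' x = g x"
    using Ck_manifoldD[OF g p] by auto
  have "Ck_on j (U \<inter> V) (\<lambda>x. h (f' x) (g' x))" if "enat j \<le> k" for j
    using f'(1,3) g'(1,3) that by (intro h) (auto intro: Ck_on_subset)
  then show "\<exists>U ga. open U \<and> p \<in> U \<and> (\<forall>j. enat j \<le> k \<longrightarrow> Ck_on j U ga) \<and>
      (\<forall>x\<in>U \<inter> M. ga x = h (f x) (g x))"
    using f' g' by (intro exI[of _ "U \<inter> V"] exI[of _ "\<lambda>x. h (f' x) (g' x)"]) auto
qed

lemma Ck_manifold_add:
  "Ck_manifold k M f \<Longrightarrow> Ck_manifold k M g \<Longrightarrow> Ck_manifold k M (\<lambda>x. f x + g x)"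
  by (rule Ck_manifold_combine) (auto intro: Ck_on_add)

lemma (in bounded_bilinear) Ck_manifold:
  "Ck_manifold k M f \<Longrightarrow> Ck_manifold k M g \<Longrightarrow> Ck_manifold k M (\<lambda>x. prod (f x) (g x))"
  by (rule Ck_manifold_combine) (auto intro: Ck_on)

lemma Ck_manifold_sum:
  "(\<And>i. i \<in> I \<Longrightarrow> Ck_manifold k M (f i)) \<Longrightarrow> Ck_manifold k M (\<lambda>x. \<Sum>i\<in>I. f i x)"
  by (induction I rule: infinite_finite_induct) (auto intro: Ck_manifold_const Ck_manifold_add)

lemma Ck_manifold_prod:
  fixes f :: "'i \<Rightarrow> 'a::euclidean_space \<Rightarrow> real"
  shows "(\<And>i. i \<in> I \<Longrightarrow> Ck_manifold k M (f i)) \<Longrightarrow> Ck_manifold k M (\<lambda>x. \<Prod>i\<in>I. f i x)"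
  by (induction I rule: infinite_finite_induct)
    (auto intro: Ck_manifold_const bounded_bilinear.Ck_manifold[OF bounded_bilinear_mult])

lemma Ck_manifold_det:
  fixes A :: "'a::euclidean_space \<Rightarrow> real ^ 'n ^ 'n"
  assumes "\<And>i j. Ck_manifold k M (\<lambda>x. A x $ i $ j)"
  shows "Ck_manifold k M (\<lambda>x. det (A x))"
  unfolding det_def
  by (intro Ck_manifold_sum bounded_bilinear.Ck_manifold[OF bounded_bilinear_mult]
      Ck_manifold_const Ck_manifold_prod assms)

section \<open>Derivatives within a submanifold from local extensions\<close>

lemma has_derivative_within_local:
  assumes "(g has_derivative D) (at p within M)" "open U" "p \<in> U" "p \<in> M"
    and eq: "\<And>x. x \<in> U \<inter> M \<Longrightarrow> g x = f x"
  shows "(f has_derivative D) (at p within M)"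
proof -
  obtain d where "d > 0" "ball p d \<subseteq> U"
    using assms(2,3) open_contains_ball by blast
  then show ?thesis
    by (intro has_derivative_transform_within[OF assms(1) _ assms(4) eq]) (auto simp: dist_commute subset_iff)
qed

lemma Ck_manifold_has_derivative:
  assumes "Ck_manifold k M f" "1 \<le> k" "p \<in> M"
  obtains D where "(f has_derivative D) (at p within M)"
proof -
  obtain U g where g: "open U" "p \<in> U" "\<And>j. enat j \<le> k \<Longrightarrow> Ck_on j U g" "\<And>x. x \<in> U \<inter> M \<Longrightarrow> g x = f x"
    using Ck_manifoldD[OF assms(1,3)] by auto
  have "Ck_on (Suc 0) U g"
    using assms(2) by (intro g(3)) (simp add: one_enat_def)
  then have "(g has_derivative frechet_derivative g (at p)) (at p within M)"
    using g(1,2) by (blast intro: Ck_on_Suc_has_derivative has_derivative_at_withinI)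
  then have "(f has_derivative frechet_derivative g (at p)) (at p within M)"
    using g(1,2) assms(3) g(4) by (rule has_derivative_within_local)
  then show ?thesis by (rule that)
qed

text \<open>Second derivatives enter here. Near \<open>p\<close> the function \<open>X f\<close>
  agrees on \<open>M\<close> with an expression in the first derivatives of one C^2 extension
  \<open>g\<close>, whereas \<open>mdiff\<close> chooses a derivative within \<open>M\<close>
  separately at each point.\<close>

lemma Ck_manifold_2_has_derivative_along:
  fixes M :: "'a::euclidean_space set" and X :: "'a \<Rightarrow> 'a"
  assumes f: "Ck_manifold 2 M f" and p: "p \<in> M"
    and X: "bounded_linear X" "\<And>q. q \<in> M \<Longrightarrow> X q \<in> tangent_space M q"
  obtains D where "(vf_apply M X f has_derivative D) (at p within M)"
proof -
  obtain U g where g: "open U" "p \<in> U" "\<And>j. enat j \<le> 2 \<Longrightarrow> Ck_on j U g" "\<And>x. x \<in> U \<inter> M \<Longrightarrow> g x = f x"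
    using Ck_manifoldD[OF f p] by auto
  have "Ck_on (Suc (Suc 0)) U g"
    by (rule g(3)) (simp add: numeral_eq_enat)
  then have g2: "Ck_on (Suc 0) U g" and g1: "\<And>v. Ck_on (Suc 0) U (\<lambda>x. frechet_derivative g (at x) v)"
    using Ck_on_Suc_imp by (blast, simp)
  \<comment> \<open>\<open>Ck_on\<close> controls derivatives only in fixed directions, hence the
    expansion of the moving vector \<open>X q\<close> in the standard basis.\<close>
  define h where "h q = (\<Sum>b\<in>Basis. (X q \<bullet> b) *\<^sub>R frechet_derivative g (at q) b)" for q
  have eq: "vf_apply M X f q = h q" if q: "q \<in> U \<inter> M" for q
  proof -
    have g': "(g has_derivative frechet_derivative g (at q)) (at q)"
      using Ck_on_Suc_has_derivative g(1) g2 q by blast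
    have "(f has_derivative frechet_derivative g (at q)) (at q within M)"
      using has_derivative_at_withinI[OF g'] g(1) _ _ g(4)
      by (rule has_derivative_within_local) (use q in auto)
    then have "vf_apply M X f q = frechet_derivative g (at q) (X q)"
      using q X(2) by (simp add: vf_apply_def mdiff_eq)
    also have "\<dots> = frechet_derivative g (at q) (\<Sum>b\<in>Basis. (X q \<bullet> b) *\<^sub>R b)"
      by (simp add: euclidean_representation)
    also have "\<dots> = h q"
      using has_derivative_linear[OF g'] by (simp add: h_def linear_sum linear_scale)
    finally show ?thesis .
  qed
  have "\<exists>D. (h has_derivative D) (at p)"
  proof -
    have *: "((\<lambda>q. (X q \<bullet> b) *\<^sub>R frechet_derivative g (at q) b) has_derivative
        (\<lambda>v. (X p \<bullet> b) *\<^sub>R frechet_derivative (\<lambda>q. frechet_derivative g (at q) b) (at p) v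
          + (X v \<bullet> b) *\<^sub>R frechet_derivative g (at p) b)) (at p)" for b
      using Ck_on_Suc_has_derivative[OF g1[of b] g(1,2)] bounded_linear_imp_has_derivative[OF X(1)]
      by (auto intro!: has_derivative_scaleR has_derivative_inner_left)
    then show ?thesis
      unfolding h_def by (intro exI) (rule has_derivative_sum, rule *)
  qed
  then obtain D where "(h has_derivative D) (at p within M)"
    using has_derivative_at_withinI by blast
  then have "(vf_apply M X f has_derivative D) (at p within M)"
    using g(1,2) p eq[symmetric] by (rule has_derivative_within_local)
  then show ?thesis by (rule that)
qed

lemma smooth_vf_has_derivative:
  assumes "smooth_vf M X" "p \<in> M"
  obtains D where "(X has_derivative D) (at p within M)"
  using assms Ck_manifold_has_derivative[of \<infinity> M X p] by (auto simp: smooth_vf_def)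

text \<open>Tailored to forms known up to sign: \<open>2 * g p * g' v = 0\<close>, and
  \<open>g p\<close> is nonzero because its square is \<open>c\<close>.\<close>

lemma derivative_eq_0_of_square_const:
  fixes g :: "'a::euclidean_space \<Rightarrow> real"
  assumes "(g has_derivative g') (at p within M)" "p \<in> M" "v \<in> tangent_space M p"
    and c: "\<And>q. q \<in> M \<Longrightarrow> (g q)\<^sup>2 = c" "c \<noteq> 0"
  shows "g' v = 0"
proof -
  have "((\<lambda>q. g q * g q) has_derivative (\<lambda>h. g p * g' h + g' h * g p)) (at p within M)"
    using assms(1) assms(1) by (rule has_derivative_mult)
  moreover have "((\<lambda>q. g q * g q) has_derivative (\<lambda>h. 0)) (at p within M)"
    using assms(2) c(1)[unfolded power2_eq_square] by (rule has_derivative_transform) auto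
  ultimately have "g p * g' v + g' v * g p = 0"
    using assms(3) by (rule tangent_derivative_unique)
  moreover have "g p \<noteq> 0"
    using c assms(2) by force
  ultimately show ?thesis by simp
qed

section \<open>The frame of the seven-sphere\<close>

lemma linear_S7_frame: "linear (S7_frame a)"
  by (rule linearI) (auto simp: S7_frame_def vec_eq_8 vec8_nth algebra_simps)

lemma bounded_linear_S7_frame: "bounded_linear (S7_frame a)"
  using linear_S7_frame linear_conv_bounded_linear by blast

lemmas S7_frame_has_derivative = bounded_linear_imp_has_derivative[OF bounded_linear_S7_frame]

lemma S7_frame_skew: "S7_frame a v \<bullet> w = - (v \<bullet> S7_frame a w)"
  by (auto simp: S7_frame_def inner_8 vec8_nth)

lemma S7_frame_inner_self: "S7_frame a v \<bullet> v = 0" "v \<bullet> S7_frame a v = 0"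
  using S7_frame_skew[of a v v] by (simp_all add: inner_commute)

lemma S7_frame_isometry:
  assumes "a \<in> {1..7}"
  shows "S7_frame a v \<bullet> S7_frame a w = v \<bullet> w"
proof -
  have "a \<in> {1,2,3,4,5,6,7}" using assms by auto
  then show ?thesis
    by (elim insertE emptyE; simp add: S7_frame_def inner_8 vec8_nth)
qed

lemma mem_tangent_space_S7: "p \<in> S7 \<Longrightarrow> v \<in> tangent_space S7 p \<longleftrightarrow> p \<bullet> v = 0"
  by (simp add: tangent_space_S7)

lemma smooth_vf_S7_frame: "smooth_vf S7 (S7_frame a)"
  using bounded_linear_S7_frame
  by (simp add: smooth_vf_def Ck_manifold_bounded_linear mem_tangent_space_S7 S7_frame_inner_self
      del: mem_sphere_0)

text \<open>Arguments of a 7-form are indexed by the type \<open>7\<close>, the frame by the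
  naturals 1 to 7. Any bijection serves: sums over the frame ignore the order, and determinants see
  it only as a sign.\<close>

definition frame_index :: "7 \<Rightarrow> nat" where
  "frame_index = (SOME \<sigma>. bij_betw \<sigma> UNIV {1..7})"

lemma bij_frame_index: "bij_betw frame_index UNIV {1..7}"
proof -
  have "\<exists>\<sigma>. bij_betw \<sigma> (UNIV :: 7 set) {1..7::nat}"
    by (rule finite_same_card_bij) simp_all
  then show ?thesis
    unfolding frame_index_def by (rule someI_ex)
qed

lemma frame_index_range: "frame_index i \<in> {1..7}"
  using bij_frame_index bij_betwE by blast

lemma frame_index_eq_iff: "frame_index i = frame_index j \<longleftrightarrow> i = j"
  using bij_frame_index by (auto simp: bij_betw_def dest: injD)

lemma frame_index_1: "\<exists>i. frame_index i = 1"
proof -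
  have "1 \<in> range frame_index"
    using bij_betw_imp_surj_on[OF bij_frame_index] by simp
  then show ?thesis by auto
qed

lemma sum_frame_index: "(\<Sum>i\<in>UNIV. h (frame_index i)) = (\<Sum>a = 1..7. h a)"
  by (rule sum.reindex_bij_betw[OF bij_frame_index])

abbreviation sphere_frame :: "7 \<Rightarrow> real ^ 8 \<Rightarrow> real ^ 8" where
  "sphere_frame i \<equiv> S7_frame (frame_index i)"

lemma sphere_frame_orthonormal:
  "p \<in> S7 \<Longrightarrow> sphere_frame i p \<bullet> sphere_frame j p = (if i = j then 1 else 0)"
  using S7_frame_orthonormal(1)[OF _ frame_index_range frame_index_range] frame_index_eq_iff by metis

lemma sphere_frame_expansion:
  assumes "p \<in> S7" "v \<in> tangent_space S7 p"
  shows "v = (\<Sum>i\<in>UNIV. (sphere_frame i p \<bullet> v) *\<^sub>R sphere_frame i p)"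
  using S7_frame_expansion[OF assms(1), of v] assms sum_frame_index[of "\<lambda>a. (S7_frame a p \<bullet> v) *\<^sub>R S7_frame a p"]
  by (simp add: mem_tangent_space_S7)

section \<open>Divergence of a field written in the frame\<close>

lemma smooth_form_alternating:
  assumes "smooth_form M \<mu>" "p \<in> M" "subspace (tangent_space M p)"
  shows "alternating_form (tangent_space M p) (\<mu> p)"
proof
  fix e :: "'b \<Rightarrow> 'a" and i j u w a b
  assume e: "\<And>i. e i \<in> tangent_space M p"
  have *: "(\<forall>i. \<forall>u\<in>tangent_space M p. \<forall>w\<in>tangent_space M p. \<forall>a b.
           \<mu> p (e(i := a *\<^sub>R u + b *\<^sub>R w)) = a * \<mu> p (e(i := u)) + b * \<mu> p (e(i := w))) \<and>
        (\<forall>i j. i \<noteq> j \<and> e i = e j \<longrightarrow> \<mu> p e = 0)"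
    using assms(1,2) e unfolding smooth_form_def by blast
  show "\<mu> p (e(i := a *\<^sub>R u + b *\<^sub>R w)) = a * \<mu> p (e(i := u)) + b * \<mu> p (e(i := w))"
    if "u \<in> tangent_space M p" "w \<in> tangent_space M p"
    using * that by blast
  show "\<mu> p e = 0" if "i \<noteq> j" "e i = e j"
    using * that by blast
qed (rule assms(3))

lemma smooth_form_smooth:
  "smooth_form M \<mu> \<Longrightarrow> (\<And>i. smooth_vf M (V i)) \<Longrightarrow> Ck_manifold \<infinity> M (\<lambda>p. \<mu> p (\<lambda>i. V i p))"
  by (simp add: smooth_form_def)

lemma subspace_tangent_space_S7: "p \<in> S7 \<Longrightarrow> subspace (tangent_space S7 p)"
  by (simp add: tangent_space_S7 subspace_hyperplane)

text \<open>Forms of top degree at a point make up a line. Moving the arguments into a determinant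
  makes their contribution explicit enough to differentiate.\<close>

lemma smooth_form_S7_eq_det:
  fixes \<mu> :: "real ^ 8 \<Rightarrow> (7 \<Rightarrow> real ^ 8) \<Rightarrow> real"
  assumes \<mu>: "smooth_form S7 \<mu>" and p: "p \<in> S7" and v: "\<And>i. v i \<in> tangent_space S7 p"
  shows "\<mu> p v = det (\<chi> i j. sphere_frame j p \<bullet> v i) * \<mu> p (\<lambda>i. sphere_frame i p)"
proof -
  interpret alternating_form "tangent_space S7 p" "\<mu> p"
    using \<mu> p subspace_tangent_space_S7[OF p] by (rule smooth_form_alternating)
  have "v = (\<lambda>i. \<Sum>j\<in>UNIV. (\<chi> i j. sphere_frame j p \<bullet> v i) $ i $ j *\<^sub>R sphere_frame j p)"
    using sphere_frame_expansion[OF p v] by simp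
  then have "\<mu> p v = \<mu> p (\<lambda>i. \<Sum>j\<in>UNIV. (\<chi> i j. sphere_frame j p \<bullet> v i) $ i $ j *\<^sub>R sphere_frame j p)"
    by (rule arg_cong)
  also have "\<dots> = det (\<chi> i j. sphere_frame j p \<bullet> v i) * \<mu> p (\<lambda>i. sphere_frame i p)"
    by (rule form_eq_det) (simp only: mem_tangent_space_S7[OF p] S7_frame_inner_self)
  finally show ?thesis .
qed

lemma divergence_sphere_frame:
  fixes \<mu> :: "real ^ 8 \<Rightarrow> (7 \<Rightarrow> real ^ 8) \<Rightarrow> real"
  assumes \<mu>: "smooth_form S7 \<mu>"
    and const: "\<And>q. q \<in> S7 \<Longrightarrow> (\<mu> q (\<lambda>i. sphere_frame i q))\<^sup>2 = c" "c \<noteq> 0"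
    and Y: "\<And>q. q \<in> S7 \<Longrightarrow> Y q = (\<Sum>i\<in>UNIV. u i q *\<^sub>R sphere_frame i q)"
    and u: "\<And>i. (u i has_derivative u' i) (at p within S7)"
    and p: "p \<in> S7"
  shows "divergence S7 \<mu> Y p = (\<Sum>i\<in>UNIV. u' i (sphere_frame i p))"
proof -
  define g where "g q = \<mu> q (\<lambda>i. sphere_frame i q)" for q
  define Y' where "Y' h = (\<Sum>i\<in>UNIV. u i p *\<^sub>R sphere_frame i h + u' i h *\<^sub>R sphere_frame i p)" for h
  have tan: "q \<in> S7 \<Longrightarrow> v \<in> tangent_space S7 q \<longleftrightarrow> q \<bullet> v = 0" for q v
    by (rule mem_tangent_space_S7)
  have frame_tan: "sphere_frame i p \<in> tangent_space S7 p" for i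
    using tan[OF p] by (simp add: S7_frame_inner_self)
  have Y_tan: "q \<bullet> Y q = 0" if "q \<in> S7" for q
    using Y[OF that] by (simp add: inner_sum_right S7_frame_inner_self)
  then have Yp: "Y p \<in> tangent_space S7 p"
    using p tan by blast
  have dY: "(Y has_derivative Y') (at p within S7)"
  proof -
    have "((\<lambda>q. \<Sum>i\<in>UNIV. u i q *\<^sub>R sphere_frame i q) has_derivative Y') (at p within S7)"
      unfolding Y'_def by (intro has_derivative_sum has_derivative_scaleR u S7_frame_has_derivative)
    with p Y show ?thesis by (rule has_derivative_transform)
  qed
  have "Ck_manifold \<infinity> S7 g"
    unfolding g_def using \<mu> smooth_vf_S7_frame by (rule smooth_form_smooth)
  then obtain g' where dg: "(g has_derivative g') (at p within S7)"
    by (rule Ck_manifold_has_derivative[OF _ _ p]) auto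
  have g'Y: "g' (Y p) = 0"
    using dg p Yp const unfolding g_def by (rule derivative_eq_0_of_square_const)
  \<comment> \<open>Entry \<open>(c, j)\<close> is the functional \<open>v \<mapsto> sphere_frame j
    p \<bullet> Y' v + sphere_frame j (Y p) \<bullet> v\<close> at the frame vector
    \<open>c\<close>. This functional is what survives of the Lie derivative below.\<close>
  define M :: "real^7^7" where "M = (\<chi> c j. sphere_frame j p \<bullet> Y' (sphere_frame c p)
    + sphere_frame j (Y p) \<bullet> sphere_frame c p)"
  have trace: "trace M = (\<Sum>i\<in>UNIV. u' i (sphere_frame i p))"
  proof -
    \<comment> \<open>The terms of \<open>Y'\<close> that differentiate the frame are orthogonal to
      \<open>sphere_frame j p\<close> by skewness; orthonormality picks out \<open>i = j\<close>
      from the others.\<close>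
    have "sphere_frame j p \<bullet> Y' (sphere_frame j p) = u' j (sphere_frame j p)" for j
    proof -
      have "sphere_frame j p \<bullet> Y' (sphere_frame j p)
          = (\<Sum>i\<in>UNIV. u' i (sphere_frame j p) * (sphere_frame j p \<bullet> sphere_frame i p))"
        by (simp add: Y'_def inner_sum_right inner_add_right S7_frame_inner_self)
      also have "\<dots> = (\<Sum>i\<in>UNIV. if j = i then u' i (sphere_frame j p) else 0)"
        by (intro sum.cong refl) (simp add: sphere_frame_orthonormal[OF p] del: mem_sphere_0)
      finally show ?thesis by simp
    qed
    \<comment> \<open>The isometry turns this into \<open>Y p \<bullet> p\<close>, which vanishes by
      tangency.\<close>
    moreover have "sphere_frame j (Y p) \<bullet> sphere_frame j p = 0" for j
      using Y_tan[OF p] by (simp add: S7_frame_isometry[OF frame_index_range] inner_commute)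
    ultimately show ?thesis
      by (simp add: trace_def M_def)
  qed
  have lie: "lie_derivative S7 Y \<mu> V p = trace M * \<mu> p (\<lambda>i. V i p)"
    if V: "\<And>i. smooth_vf S7 (V i)" for V :: "7 \<Rightarrow> real ^ 8 \<Rightarrow> real ^ 8"
  proof -
    define C :: "real ^ 8 \<Rightarrow> real^7^7" where "C q = (\<chi> i j. sphere_frame j q \<bullet> V i q)" for q
    have V_tan: "V i q \<in> tangent_space S7 q" if "q \<in> S7" for i q
      using V that by (auto simp: smooth_vf_def)
    have "\<forall>i. \<exists>D. (V i has_derivative D) (at p within S7)"
      using V p smooth_vf_has_derivative by metis
    then obtain V' where dV: "\<And>i. (V i has_derivative V' i) (at p within S7)"
      by metis
    define C' :: "real ^ 8 \<Rightarrow> real^7^7" where "C' h = (\<chi> i j. sphere_frame j p \<bullet> V' i h + sphere_frame j h \<bullet> V i p)" for h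
    have dC: "((\<lambda>q. det (C q)) has_derivative
        (\<lambda>h. \<Sum>k\<in>UNIV. det (\<chi> i. if i = k then C' h $ i else C p $ i))) (at p within S7)"
      by (rule has_derivative_det)
        (auto simp: C_def C'_def intro!: has_derivative_inner S7_frame_has_derivative dV)
    have \<mu>V: "\<mu> q (\<lambda>i. V i q) = det (C q) * g q" if "q \<in> S7" for q
      unfolding C_def g_def using \<mu> that V_tan[OF that] by (rule smooth_form_S7_eq_det)
    have "((\<lambda>q. \<mu> q (\<lambda>i. V i q)) has_derivative (\<lambda>h. det (C p) * g' h
        + (\<Sum>k\<in>UNIV. det (\<chi> i. if i = k then C' h $ i else C p $ i)) * g p)) (at p within S7)"
      using p \<mu>V has_derivative_mult[OF dC dg] by (rule has_derivative_transform)
    then have "vf_apply S7 Y (\<lambda>q. \<mu> q (\<lambda>i. V i q)) p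
        = (\<Sum>k\<in>UNIV. det (\<chi> i. if i = k then C' (Y p) $ i else C p $ i)) * g p"
      using Yp g'Y by (simp add: vf_apply_def mdiff_eq)
    moreover
    define b where "b i = lie_bracket S7 Y (V i) p" for i
    have b: "b i = V' i (Y p) - Y' (V i p)" for i
      using mdiff_eq[OF dV Yp] mdiff_eq[OF dY V_tan[OF p]]
      by (simp add: b_def lie_bracket_def vf_apply_def)
    \<comment> \<open>Tangency of the bracket: differentiating \<open>q \<bullet> V i q = 0\<close>
      along \<open>Y\<close> and \<open>q \<bullet> Y q = 0\<close> along \<open>V i\<close> gives
      the same value.\<close>
    have "p \<bullet> b i = 0" for i
      using orthogonal_field_derivative[OF p Yp bounded_linear_ident _ dV[of i]]
        orthogonal_field_derivative[OF p V_tan[OF p, of i] bounded_linear_ident _ dY]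
        V_tan tan Y_tan by (simp add: b inner_diff_right inner_commute del: mem_sphere_0)
    then have b_tan: "b i \<in> tangent_space S7 p" for i
      using tan[OF p] by simp
    have "\<mu> p ((\<lambda>j. V j p)(k := b k))
        = det (\<chi> i. if i = k then (\<chi> j. sphere_frame j p \<bullet> b i) else C p $ i) * g p" for k
    proof -
      have "((\<lambda>j. V j p)(k := b k)) i \<in> tangent_space S7 p" for i
        using b_tan V_tan[OF p] by simp
      from smooth_form_S7_eq_det[OF \<mu> p, where v = "(\<lambda>j. V j p)(k := b k)", OF this]
      have "\<mu> p ((\<lambda>j. V j p)(k := b k))
          = det (\<chi> i j. sphere_frame j p \<bullet> ((\<lambda>j. V j p)(k := b k)) i) * g p"
        by (simp add: g_def)
      also have "(\<chi> i j. sphere_frame j p \<bullet> ((\<lambda>j. V j p)(k := b k)) i)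
          = (\<chi> i. if i = k then (\<chi> j. sphere_frame j p \<bullet> b i) else C p $ i)"
        by (simp add: vec_eq_iff C_def)
      finally show ?thesis .
    qed
    \<comment> \<open>The derivative \<open>V' i (Y p)\<close> occurs in \<open>C' (Y p)\<close> and
      in the bracket and cancels. The rest is linear in \<open>V i p\<close>, and expanding this
      vector in the frame yields a row of the product.\<close>
    moreover have "C' (Y p) $ i - (\<chi> j. sphere_frame j p \<bullet> b i) = (C p ** M) $ i" for i
    proof -
      have "sphere_frame j p \<bullet> Y' (V i p) + sphere_frame j (Y p) \<bullet> V i p = (C p ** M) $ i $ j" for j
      proof -
        define h where "h v = sphere_frame j p \<bullet> Y' v + sphere_frame j (Y p) \<bullet> v" for v
        have "linear Y'"
          using dY by (rule has_derivative_linear)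
        then have "linear h"
          unfolding h_def by (intro linearI) (simp_all add: linear_add linear_scale inner_add_right algebra_simps)
        then have "h (\<Sum>c\<in>UNIV. (sphere_frame c p \<bullet> V i p) *\<^sub>R sphere_frame c p)
            = (\<Sum>c\<in>UNIV. (sphere_frame c p \<bullet> V i p) * h (sphere_frame c p))"
          by (simp add: linear_sum linear_scale)
        then have "h (V i p) = (\<Sum>c\<in>UNIV. (sphere_frame c p \<bullet> V i p) * h (sphere_frame c p))"
          by (simp only: sphere_frame_expansion[OF p V_tan[OF p, of i], symmetric])
        then show ?thesis
          by (simp add: matrix_matrix_mult_def C_def M_def h_def)
      qed
      then show ?thesis
        by (simp add: vec_eq_iff C'_def b inner_diff_right add.commute)
    qed
    ultimately have "lie_derivative S7 Y \<mu> V p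
        = (\<Sum>k\<in>UNIV. det (\<chi> i. if i = k then (C p ** M) $ i else C p $ i)) * g p"
      unfolding lie_derivative_def b_def[symmetric]
      by (simp only: sum_distrib_right[symmetric] left_diff_distrib[symmetric]
          sum_subtractf[symmetric] det_row_diff)
    also have "\<dots> = trace M * \<mu> p (\<lambda>i. V i p)"
      by (simp add: sum_det_replace_rows \<mu>V[OF p])
    finally show ?thesis .
  qed
  have "divergence S7 \<mu> Y p = trace M"
    unfolding divergence_def
  proof (rule the_equality)
    \<comment> \<open>Uniqueness is tested on the frame itself, where the form has the nonzero value
      \<open>g p\<close>.\<close>
    fix d assume d: "\<forall>V. (\<forall>i. smooth_vf S7 (V i)) \<longrightarrow> lie_derivative S7 Y \<mu> V p = d * \<mu> p (\<lambda>i. V i p)"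
    then have "lie_derivative S7 Y \<mu> sphere_frame p = d * g p"
      using smooth_vf_S7_frame by (simp add: g_def)
    then have "trace M * g p = d * g p"
      using lie[of sphere_frame] smooth_vf_S7_frame by (simp add: g_def)
    moreover have "g p \<noteq> 0"
      using const p unfolding g_def by force
    ultimately show "d = trace M" by simp
  qed (use lie in blast)
  then show ?thesis by (simp add: trace)
qed

section \<open>Popp's volume of the contact distribution\<close>

lemma inner_tensor: "tensor x y \<bullet> tensor x' y' = (x \<bullet> x') * (y \<bullet> y')"
  by (simp add: tensor_def inner_vec_def sum_product algebra_simps)

lemma linear_tensor_left: "linear (\<lambda>x. tensor x y)"
  by (rule linearI) (simp_all add: tensor_def vec_eq_iff algebra_simps)

lemma linear_tensor_right: "linear (tensor x)"
  by (rule linearI) (simp_all add: tensor_def vec_eq_iff algebra_simps)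

lemma mem_contact_distribution:
  "p \<in> S7 \<Longrightarrow> v \<in> contact_distribution p \<longleftrightarrow> p \<bullet> v = 0 \<and> S7_frame 1 p \<bullet> v = 0"
  by (simp add: contact_distribution_def mem_tangent_space_S7 contact_form_eq del: mem_sphere_0)

lemma subspace_contact_distribution: "p \<in> S7 \<Longrightarrow> subspace (contact_distribution p)"
  by (simp add: contact_distribution_eq_span)

lemma contact_distribution_tangent: "contact_distribution p \<subseteq> tangent_space S7 p"
  by (auto simp: contact_distribution_def)

lemma frame_mem_contact_distribution:
  assumes "p \<in> S7" "a \<in> {2..7}"
  shows "S7_frame a p \<in> contact_distribution p"
  unfolding contact_distribution_eq_span[OF assms(1)] using assms(2) by (intro span_base) auto

lemma contact_expansion:
  assumes "p \<in> S7" "v \<in> contact_distribution p"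
  shows "v = (\<Sum>a = 2..7. (S7_frame a p \<bullet> v) *\<^sub>R S7_frame a p)"
proof -
  have "{1..7::nat} = insert 1 {2..7}" by auto
  then show ?thesis
    using S7_frame_expansion[OF assms(1), of v] assms by (simp add: mem_contact_distribution del: mem_sphere_0)
qed

lemma contact_extension:
  assumes "p \<in> S7" "v \<in> contact_distribution p"
  shows "\<exists>X. horizontal_vf S7 contact_distribution X \<and> X p = v"
proof (intro exI conjI)
  \<comment> \<open>Freezing the frame coefficients of \<open>v\<close> at \<open>p\<close> gives a
    linear, hence smooth, field.\<close>
  let ?X = "\<lambda>q. \<Sum>a = 2..7. (S7_frame a p \<bullet> v) *\<^sub>R S7_frame a q"
  have H: "?X q \<in> contact_distribution q" if "q \<in> S7" for q
    using that by (intro subspace_sum subspace_scale subspace_contact_distribution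
      frame_mem_contact_distribution)
  then have "?X q \<in> tangent_space S7 q" if "q \<in> S7" for q
    using that contact_distribution_tangent by blast
  moreover have "bounded_linear ?X"
    by (intro bounded_linear_sum bounded_linear_const_scaleR bounded_linear_S7_frame)
  ultimately show "horizontal_vf S7 contact_distribution ?X"
    using H by (simp add: horizontal_vf_def smooth_vf_def Ck_manifold_bounded_linear del: mem_sphere_0)
  show "?X p = v"
    using contact_expansion[OF assms] by simp
qed

lemma S7_frame_1_contact:
  assumes "p \<in> S7" "v \<in> contact_distribution p"
  shows "S7_frame 1 v \<in> contact_distribution p"
  using assms S7_frame_skew[of 1 p v]
  by (simp add: mem_contact_distribution S7_frame_isometry inner_commute del: mem_sphere_0)

section \<open>Brackets of horizontal fields and the tensor that represents them\<close>

lemma contact_lie_bracket: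
  assumes p: "p \<in> S7"
    and X: "horizontal_vf S7 contact_distribution X" and Y: "horizontal_vf S7 contact_distribution Y"
  shows "p \<bullet> lie_bracket S7 X Y p = 0"
    and "S7_frame 1 p \<bullet> lie_bracket S7 X Y p = - 2 * (S7_frame 1 (X p) \<bullet> Y p)"
proof -
  obtain X' where X': "(X has_derivative X') (at p within S7)"
    using X p smooth_vf_has_derivative unfolding horizontal_vf_def by blast
  obtain Y' where Y': "(Y has_derivative Y') (at p within S7)"
    using Y p smooth_vf_has_derivative unfolding horizontal_vf_def by blast
  have orth: "q \<bullet> X q = 0" "S7_frame 1 q \<bullet> X q = 0" "q \<bullet> Y q = 0" "S7_frame 1 q \<bullet> Y q = 0"
    if "q \<in> S7" for q
    using X Y mem_contact_distribution that unfolding horizontal_vf_def by blast+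
  have tan: "X p \<in> tangent_space S7 p" "Y p \<in> tangent_space S7 p"
    using X Y p by (auto simp: horizontal_vf_def smooth_vf_def simp del: mem_sphere_0)
  have b: "lie_bracket S7 X Y p = Y' (X p) - X' (Y p)"
    using mdiff_eq[OF X' tan(2)] mdiff_eq[OF Y' tan(1)] by (simp add: lie_bracket_def vf_apply_def)
  show "p \<bullet> lie_bracket S7 X Y p = 0"
    using orthogonal_field_derivative[OF p tan(1) bounded_linear_ident orth(3) Y']
      orthogonal_field_derivative[OF p tan(2) bounded_linear_ident orth(1) X']
    by (simp add: b inner_diff_right inner_commute)
  \<comment> \<open>Both halves of the bracket contribute the same amount, by skewness of
    \<open>S7_frame 1\<close>; hence the factor 2.\<close>
  show "S7_frame 1 p \<bullet> lie_bracket S7 X Y p = - 2 * (S7_frame 1 (X p) \<bullet> Y p)"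
    using orthogonal_field_derivative[OF p tan(1) bounded_linear_S7_frame orth(4) Y']
      orthogonal_field_derivative[OF p tan(2) bounded_linear_S7_frame orth(2) X']
      S7_frame_skew[of 1 "X p" "Y p"]
    by (simp add: b inner_diff_right inner_commute)
qed

text \<open>The tensor representing the bracket map: \<open>X\<^sub>1 \<bullet> [X, Y] = - 2 J X \<bullet> Y\<close> for horizontal
  \<open>X\<close>, \<open>Y\<close>, where \<open>J\<close> is the linear map \<open>S7_frame 1\<close>.\<close>

definition contact_tensor :: "real ^ 8 \<Rightarrow> real ^ 8 ^ 8" where
  "contact_tensor p = - 2 *\<^sub>R (\<Sum>a = 2..7. tensor (S7_frame a p) (S7_frame 1 (S7_frame a p)))"

lemma contact_tensor_inner:
  assumes "p \<in> S7" "x \<in> contact_distribution p"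
  shows "contact_tensor p \<bullet> tensor x y = - 2 * (S7_frame 1 x \<bullet> y)"
proof -
  have "S7_frame 1 x = (\<Sum>a = 2..7. (S7_frame a p \<bullet> x) *\<^sub>R S7_frame 1 (S7_frame a p))"
    by (subst contact_expansion[OF assms]) (simp add: linear_S7_frame linear_sum linear_scale)
  then show ?thesis
    by (simp add: contact_tensor_def inner_sum_left inner_tensor)
qed

lemma contact_tensor_mem:
  assumes "p \<in> S7"
  shows "contact_tensor p \<in> tensor_square (contact_distribution p)"
  unfolding contact_tensor_def tensor_square_def
  using assms frame_mem_contact_distribution S7_frame_1_contact
  by (intro span_scale span_sum span_base) blast

text \<open>24 is six times the square of -2: each of the six horizontal frame vectors is sent to a
  unit vector by \<open>S7_frame 1\<close>, and -2 enters once through the definition and once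
  through \<open>contact_tensor_inner\<close>.\<close>

lemma contact_tensor_norm:
  assumes "p \<in> S7"
  shows "contact_tensor p \<bullet> contact_tensor p = 24"
proof -
  have "contact_tensor p \<bullet> tensor (S7_frame a p) (S7_frame 1 (S7_frame a p)) = - 2"
    if "a \<in> {2..7}" for a
    using contact_tensor_inner[OF assms frame_mem_contact_distribution[OF assms that]]
      S7_frame_orthonormal[OF assms, of a a] that by (simp add: S7_frame_isometry)
  then show ?thesis
    by (subst contact_tensor_def) (simp add: inner_sum_right inner_commute[of _ "contact_tensor p"])
qed

text \<open>\<open>bracket_class\<close> asks for a sum of pure tensors without coefficients. Here
  they are absorbed into the second factors, while the first factors are values of frame
  fields.\<close>

lemma tensor_square_representation:
  assumes p: "p \<in> S7" and \<tau>: "\<tau> \<in> tensor_square (contact_distribution p)"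
  obtains w where "\<And>a. w a \<in> contact_distribution p"
    and "\<tau> = (\<Sum>a = 2..7. tensor (S7_frame a p) (w a))"
proof -
  let ?H = "contact_distribution p"
  let ?R = "{\<Sum>a = 2..7. tensor (S7_frame a p) (w a) | w. \<forall>a::nat. w a \<in> ?H}"
  have H: "subspace ?H"
    using p by (rule subspace_contact_distribution)
  have "subspace ?R"
    unfolding subspace_def
  proof (intro conjI ballI allI)
    show "0 \<in> ?R"
      using H by (auto intro!: exI[of _ "\<lambda>_. 0"] simp: subspace_0 linear_0 linear_tensor_right)
  next
    fix s t assume "s \<in> ?R" "t \<in> ?R"
    then obtain w v where "\<forall>a::nat. w a \<in> ?H" "\<forall>a::nat. v a \<in> ?H"
      "s = (\<Sum>a = 2..7. tensor (S7_frame a p) (w a))" "t = (\<Sum>a = 2..7. tensor (S7_frame a p) (v a))"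
      by blast
    then show "s + t \<in> ?R"
      using H by (auto intro!: exI[of _ "\<lambda>a. w a + v a"]
        simp: subspace_add linear_add linear_tensor_right sum.distrib)
  next
    fix c s assume "s \<in> ?R"
    then obtain w where "\<forall>a::nat. w a \<in> ?H" "s = (\<Sum>a = 2..7. tensor (S7_frame a p) (w a))"
      by blast
    then show "c *\<^sub>R s \<in> ?R"
      using H by (auto intro!: exI[of _ "\<lambda>a. c *\<^sub>R w a"]
        simp: subspace_scale linear_scale linear_tensor_right scaleR_sum_right)
  qed
  moreover have "{tensor x y | x y. x \<in> ?H \<and> y \<in> ?H} \<subseteq> ?R"
  proof clarify
    fix x y assume x: "x \<in> ?H" and y: "y \<in> ?H"
    have "tensor x y = (\<Sum>a = 2..7. tensor (S7_frame a p) ((S7_frame a p \<bullet> x) *\<^sub>R y))"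
      by (subst contact_expansion[OF p x])
        (simp add: linear_sum[OF linear_tensor_left] linear_scale[OF linear_tensor_left]
          linear_scale[OF linear_tensor_right])
    then show "\<exists>w. tensor x y = (\<Sum>a = 2..7. tensor (S7_frame a p) (w a)) \<and> (\<forall>a. w a \<in> ?H)"
      using H y by (auto intro!: exI[of _ "\<lambda>a. (S7_frame a p \<bullet> x) *\<^sub>R y"] simp: subspace_scale)
  qed
  ultimately have "\<tau> \<in> ?R"
    using \<tau> span_minimal unfolding tensor_square_def by blast
  then show ?thesis
    using that by blast
qed

text \<open>Tensoriality: whichever fields represent \<open>\<tau>\<close>, their brackets have the
  same \<open>S7_frame 1 p\<close> component, since that component depends only on the values at
  \<open>p\<close>. The converse inclusion needs one actual representation, obtained by extending
  the factors of a tensor decomposition to horizontal fields.\<close>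

lemma bracket_class_contact:
  assumes p: "p \<in> S7" and \<tau>: "\<tau> \<in> tensor_square (contact_distribution p)"
  shows "bracket_class S7 contact_distribution p \<tau>
    = {v. p \<bullet> v = 0 \<and> S7_frame 1 p \<bullet> v = contact_tensor p \<bullet> \<tau>}"
proof -
  let ?H = contact_distribution
  have *: "v - (\<Sum>i<m. lie_bracket S7 (X i) (Y i) p) \<in> ?H p \<longleftrightarrow>
      S7_frame 1 p \<bullet> v = contact_tensor p \<bullet> (\<Sum>i<m. tensor (X i p) (Y i p))"
    if v: "p \<bullet> v = 0" and XY: "\<forall>i<m. horizontal_vf S7 ?H (X i) \<and> horizontal_vf S7 ?H (Y i)"
    for v and m :: nat and X Y
  proof -
    have "contact_tensor p \<bullet> tensor (X i p) (Y i p) = S7_frame 1 p \<bullet> lie_bracket S7 (X i) (Y i) p"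
      and "p \<bullet> lie_bracket S7 (X i) (Y i) p = 0" if "i < m" for i
    proof -
      have h: "horizontal_vf S7 ?H (X i)" "horizontal_vf S7 ?H (Y i)"
        using XY that by auto
      then have "X i p \<in> ?H p"
        using p unfolding horizontal_vf_def by blast
      then show "contact_tensor p \<bullet> tensor (X i p) (Y i p)
          = S7_frame 1 p \<bullet> lie_bracket S7 (X i) (Y i) p"
        using contact_tensor_inner[OF p] contact_lie_bracket(2)[OF p h] by simp
      show "p \<bullet> lie_bracket S7 (X i) (Y i) p = 0"
        using contact_lie_bracket(1)[OF p h] .
    qed
    then show ?thesis
      using v by (auto simp: mem_contact_distribution[OF p] inner_diff_right inner_sum_right
          simp del: mem_sphere_0)
  qed
  show ?thesis
  proof (intro equalityI subsetI)
    fix v assume "v \<in> bracket_class S7 ?H p \<tau>"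
    then obtain m X Y where "v \<in> tangent_space S7 p"
      and "\<forall>i<(m::nat). horizontal_vf S7 ?H (X i) \<and> horizontal_vf S7 ?H (Y i)"
      and "\<tau> = (\<Sum>i<m. tensor (X i p) (Y i p))"
      and "v - (\<Sum>i<m. lie_bracket S7 (X i) (Y i) p) \<in> ?H p"
      unfolding bracket_class_def by blast
    with * show "v \<in> {v. p \<bullet> v = 0 \<and> S7_frame 1 p \<bullet> v = contact_tensor p \<bullet> \<tau>}"
      using p by (simp add: mem_tangent_space_S7 del: mem_sphere_0)
  next
    fix v assume v: "v \<in> {v. p \<bullet> v = 0 \<and> S7_frame 1 p \<bullet> v = contact_tensor p \<bullet> \<tau>}"
    obtain w where w: "\<And>a. w a \<in> ?H p" "\<tau> = (\<Sum>a = 2..7. tensor (S7_frame a p) (w a))"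
      using p \<tau> tensor_square_representation by blast
    obtain W where W: "\<And>a. horizontal_vf S7 ?H (W a)" "\<And>a. W a p = w a"
      using contact_extension[OF p w(1)] by metis
    \<comment> \<open>The shift by 2 matches the frame indices 2 to 7 with the range
      \<open>i < 6\<close> of \<open>bracket_class\<close>.\<close>
    define X where "X i = S7_frame (i + 2)" for i
    have "horizontal_vf S7 ?H (X i)" if "i < 6" for i
      using that smooth_vf_S7_frame frame_mem_contact_distribution
      by (simp add: X_def horizontal_vf_def del: mem_sphere_0)
    then have h: "\<forall>i<6. horizontal_vf S7 ?H (X i) \<and> horizontal_vf S7 ?H (W (i + 2))"
      using W(1) by simp
    have "(\<Sum>i<6. tensor (X i p) (W (i + 2) p)) = \<tau>"
      unfolding w(2) X_def W(2)
      by (rule sum.reindex_bij_witness[of _ "\<lambda>a. a - 2" "\<lambda>i. i + 2"]) auto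
    moreover from this have "v - (\<Sum>i<6. lie_bracket S7 (X i) (W (i + 2)) p) \<in> ?H p"
      using *[OF _ h] v by simp
    moreover have "v \<in> tangent_space S7 p"
      using v mem_tangent_space_S7[OF p] by simp
    ultimately show "v \<in> bracket_class S7 ?H p \<tau>"
      unfolding bracket_class_def using h
      by (intro CollectI conjI exI[where x = "6::nat"] exI[where x = X] exI[where x = "\<lambda>i. W (i + 2)"]) auto
  qed
qed

lemma subspace_tensor_square: "subspace (tensor_square S)"
  by (simp add: tensor_square_def)

text \<open>If the class of \<open>\<tau>\<close> is the distribution itself, it contains
  \<open>0\<close>, which forces \<open>contact_tensor p \<bullet> \<tau> = 0\<close>. Inside the
  tensor square the complement of the kernel is thus the line through
  \<open>contact_tensor p\<close>.\<close>

lemma bracket_kernel_contact: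
  assumes p: "p \<in> S7"
  shows "bracket_kernel S7 contact_distribution p
    = {\<tau> \<in> tensor_square (contact_distribution p). contact_tensor p \<bullet> \<tau> = 0}"
proof -
  have "bracket_class S7 contact_distribution p \<tau> = contact_distribution p
      \<longleftrightarrow> contact_tensor p \<bullet> \<tau> = 0"
    if "\<tau> \<in> tensor_square (contact_distribution p)" for \<tau>
    unfolding bracket_class_contact[OF p that]
    using mem_contact_distribution[OF p] inner_zero_right[of p] by fastforce
  then show ?thesis
    unfolding bracket_kernel_def by blast
qed

text \<open>The multiple of \<open>contact_tensor p\<close> is fixed by its squared norm 24. Two
  candidates differ by an element of the kernel that is also orthogonal to the kernel, hence by
  zero.\<close>

lemma quotient_lift_contact:
  assumes p: "p \<in> S7" and v: "v \<in> tangent_space S7 p"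
  shows "quotient_lift S7 contact_distribution p v = ((S7_frame 1 p \<bullet> v) / 24) *\<^sub>R contact_tensor p"
    (is "_ = ?\<tau>")
  unfolding quotient_lift_def
proof (rule the_equality)
  let ?T = "tensor_square (contact_distribution p)"
  have T: "?\<tau> \<in> ?T"
    using contact_tensor_mem[OF p] subspace_tensor_square by (rule subspace_scale[rotated])
  have v0: "p \<bullet> v = 0"
    using p v by (simp add: mem_tangent_space_S7 del: mem_sphere_0)
  show "?\<tau> \<in> ?T \<and> (\<forall>\<kappa>\<in>bracket_kernel S7 contact_distribution p. ?\<tau> \<bullet> \<kappa> = 0) \<and>
      v \<in> bracket_class S7 contact_distribution p ?\<tau>"
    using T v0 bracket_class_contact[OF p T] contact_tensor_norm[OF p]
    by (auto simp: bracket_kernel_contact[OF p] simp del: mem_sphere_0)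
  fix \<tau> assume \<tau>: "\<tau> \<in> ?T \<and> (\<forall>\<kappa>\<in>bracket_kernel S7 contact_distribution p. \<tau> \<bullet> \<kappa> = 0) \<and>
      v \<in> bracket_class S7 contact_distribution p \<tau>"
  have k: "\<tau> - ?\<tau> \<in> bracket_kernel S7 contact_distribution p"
    using \<tau> T bracket_class_contact[OF p, of \<tau>] contact_tensor_norm[OF p] subspace_tensor_square
    by (auto simp: bracket_kernel_contact[OF p] inner_diff_right simp del: mem_sphere_0
      intro!: subspace_diff)
  then have "contact_tensor p \<bullet> (\<tau> - ?\<tau>) = 0"
    by (simp add: bracket_kernel_contact[OF p])
  moreover have "\<tau> \<bullet> (\<tau> - ?\<tau>) = 0"
    using \<tau> k by blast
  ultimately have "(\<tau> - ?\<tau>) \<bullet> (\<tau> - ?\<tau>) = 0"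
    by (subst inner_diff_left) simp
  then show "\<tau> = ?\<tau>" by simp
qed

lemma quotient_inner_contact:
  assumes "p \<in> S7" "v \<in> tangent_space S7 p" "w \<in> tangent_space S7 p"
  shows "quotient_inner S7 contact_distribution p v w
    = (S7_frame 1 p \<bullet> v) * (S7_frame 1 p \<bullet> w) / 24"
  using assms by (simp add: quotient_inner_def quotient_lift_contact contact_tensor_norm del: mem_sphere_0)

section \<open>The step-two property and the value of a Popp form on the frame\<close>

lemma dim_contact_distribution:
  assumes p: "p \<in> S7"
  shows "dim (contact_distribution p) = 6"
proof -
  let ?F = "\<lambda>a. S7_frame a p"
  have orth: "?F a \<bullet> ?F b = (if a = b then 1 else 0)" if "a \<in> {2..7}" "b \<in> {2..7}" for a b
    using S7_frame_orthonormal(1)[OF p, of a b] that by simp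
  have "inj_on ?F {2..7}"
  proof (rule inj_onI)
    fix a b assume "a \<in> {2..7}" "b \<in> {2..7}" "?F a = ?F b"
    then show "a = b"
      using orth[of a b] orth[of a a] by (simp split: if_splits)
  qed
  moreover have "independent (?F ` {2..7})"
  proof (rule pairwise_orthogonal_independent)
    show "pairwise orthogonal (?F ` {2..7})"
      using orth unfolding pairwise_def orthogonal_def by fastforce
    show "0 \<notin> ?F ` {2..7}"
      using orth by fastforce
  qed
  ultimately show ?thesis
    unfolding contact_distribution_eq_span[OF p] by (simp add: dim_eq_card_independent card_image)
qed

lemma step_two_contact: "step_two_distribution S7 contact_distribution"
  unfolding step_two_distribution_def
proof (intro conjI ballI exI[of _ "6::nat"])
  fix p v assume p: "p \<in> S7" and v: "v \<in> tangent_space S7 p"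
  \<comment> \<open>The preimage is the minimal one, the tensor found in
    \<open>quotient_lift_contact\<close>.\<close>
  let ?\<tau> = "((S7_frame 1 p \<bullet> v) / 24) *\<^sub>R contact_tensor p"
  have T: "?\<tau> \<in> tensor_square (contact_distribution p)"
    using contact_tensor_mem[OF p] subspace_tensor_square by (rule subspace_scale[rotated])
  then have "v \<in> bracket_class S7 contact_distribution p ?\<tau>"
    using bracket_class_contact[OF p T] v mem_tangent_space_S7[OF p] contact_tensor_norm[OF p] by simp
  with T show "\<exists>\<tau>\<in>tensor_square (contact_distribution p). v \<in> bracket_class S7 contact_distribution p \<tau>"
    by blast
qed (use dim_contact_distribution subspace_contact_distribution contact_distribution_tangent
    contact_extension in blast)+

lemma popp_frame_square:
  assumes \<mu>: "popp_volume_form S7 contact_distribution \<mu>" and p: "p \<in> S7"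
  shows "(\<mu> p (\<lambda>i. sphere_frame i p))\<^sup>2 = 1 / 24"
proof -
  obtain k where k: "frame_index k = 1"
    using frame_index_1 by blast
  have form: "smooth_form S7 \<mu>"
    using \<mu> by (simp add: popp_volume_form_def)
  interpret alternating_form "tangent_space S7 p" "\<mu> p"
    using form p subspace_tangent_space_S7[OF p] by (rule smooth_form_alternating)
  have tan: "sphere_frame i p \<in> tangent_space S7 p" for i
    using mem_tangent_space_S7[OF p] S7_frame_inner_self by simp
  \<comment> \<open>The orthogonal projection: a splitting that kills the first frame vector, which
    then has only a quotient component.\<close>
  define P where "P v = (\<Sum>a = 2..7. (S7_frame a p \<bullet> v) *\<^sub>R S7_frame a p)" for v
  \<comment> \<open>In the quotient the first frame vector has squared length 1/24, so
    \<open>sqrt 24\<close> normalises it.\<close>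
  define e where "e = (\<lambda>i. sphere_frame i p)(k := sqrt 24 *\<^sub>R sphere_frame k p)"
  have P_H: "P v \<in> contact_distribution p" for v
    unfolding P_def using p by (intro subspace_sum subspace_scale subspace_contact_distribution
      frame_mem_contact_distribution)
  have "linear P"
    unfolding P_def
    by (rule linearI) (simp_all add: inner_add_right scaleR_add_left sum.distrib scaleR_sum_right)
  moreover have "P v = v" if "v \<in> contact_distribution p" for v
    unfolding P_def using contact_expansion[OF p that] by simp
  ultimately have split: "splitting S7 contact_distribution p P"
    using P_H by (simp add: splitting_def)
  have P_frame: "P (sphere_frame i p) = (if i = k then 0 else sphere_frame i p)" for i
  proof (cases "i = k")
    case True
    have "P (S7_frame 1 p) = 0"
      unfolding P_def using S7_frame_orthonormal(1)[OF p, of _ 1] by (intro sum.neutral) simp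
    then show ?thesis using True k by simp
  next
    case False
    then have "frame_index i \<noteq> 1"
      using k frame_index_eq_iff by metis
    then have "frame_index i \<in> {2..7}"
      using frame_index_range[of i] by auto
    then show ?thesis
      using False \<open>\<And>v. v \<in> contact_distribution p \<Longrightarrow> P v = v\<close> frame_mem_contact_distribution[OF p] by simp
  qed
  have e_tan: "e i \<in> tangent_space S7 p" for i
    using tan subspace_tangent_space_S7[OF p] by (simp add: e_def subspace_scale)
  have "P (e i) = (if i = k then 0 else sphere_frame i p)" for i
    using P_frame \<open>linear P\<close> by (simp add: e_def linear_scale)
  moreover have "S7_frame 1 p \<bullet> e i = (if i = k then sqrt 24 else 0)" for i
    using sphere_frame_orthonormal[OF p, of k i] sphere_frame_orthonormal[OF p, of k k]
    by (simp add: e_def k)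
  ultimately have "split_inner S7 contact_distribution P p (e i) (e j) = (if i = j then 1 else 0)" for i j
    unfolding split_inner_def quotient_inner_contact[OF p e_tan e_tan]
    by (simp add: sphere_frame_orthonormal[OF p] del: mem_sphere_0)
  then have "\<bar>\<mu> p e\<bar> = 1"
    using \<mu> p split e_tan unfolding popp_volume_form_def by blast
  moreover have "\<mu> p e = sqrt 24 * \<mu> p (\<lambda>i. sphere_frame i p)"
    unfolding e_def using form_scaleR[where e = "\<lambda>i. sphere_frame i p" and i = k and a = "sqrt 24", OF tan tan[of k]]
    by (simp add: fun_upd_idem)
  ultimately have "(sqrt 24 * \<mu> p (\<lambda>i. sphere_frame i p))\<^sup>2 = 1"
    by (metis abs_1 power2_abs power_one)
  then show ?thesis
    by (simp add: power_mult_distrib)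
qed

section \<open>Existence of a Popp form\<close>

lemma smooth_form_frame_det:
  "smooth_form S7 (\<lambda>p e. c * det (\<chi> i j. sphere_frame j p \<bullet> e i))"
  unfolding smooth_form_def
proof (intro conjI ballI allI impI)
  fix p :: "real ^ 8" and e :: "7 \<Rightarrow> real ^ 8" and i u w a b
  have row: "(\<chi> k j. sphere_frame j p \<bullet> (e(i := x)) k) =
      (\<chi> k. if k = i then (\<chi> j. sphere_frame j p \<bullet> x) else (\<chi> j. sphere_frame j p \<bullet> e k))" for x
    by (simp add: vec_eq_iff)
  have "(\<chi> j. sphere_frame j p \<bullet> (a *\<^sub>R u + b *\<^sub>R w))
      = a *s (\<chi> j. sphere_frame j p \<bullet> u) + b *s (\<chi> j. sphere_frame j p \<bullet> w)"
    by (simp add: vec_eq_iff inner_add_right)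
  then show "c * det (\<chi> k j. sphere_frame j p \<bullet> (e(i := a *\<^sub>R u + b *\<^sub>R w)) k)
      = a * (c * det (\<chi> k j. sphere_frame j p \<bullet> (e(i := u)) k))
        + b * (c * det (\<chi> k j. sphere_frame j p \<bullet> (e(i := w)) k))"
    unfolding row by (simp only: det_row_add det_row_mul) (simp add: algebra_simps)
next
  fix p and e :: "7 \<Rightarrow> real ^ 8" and i j
  assume "i \<noteq> j \<and> e i = e j"
  then have "det (\<chi> i j. sphere_frame j p \<bullet> e i) = 0"
    by (intro det_identical_rows[of i j]) (auto simp: row_def)
  then show "c * det (\<chi> i j. sphere_frame j p \<bullet> e i) = 0" by simp
next
  fix V :: "7 \<Rightarrow> real ^ 8 \<Rightarrow> real ^ 8"
  assume V: "\<forall>i. smooth_vf S7 (V i)"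
  show "Ck_manifold \<infinity> S7 (\<lambda>p. c * det (\<chi> i j. sphere_frame j p \<bullet> V i p))"
  proof (intro bounded_bilinear.Ck_manifold[OF bounded_bilinear_mult] Ck_manifold_const Ck_manifold_det)
    fix i j
    have "Ck_manifold \<infinity> S7 (\<lambda>p. sphere_frame j p \<bullet> V i p)"
      using V smooth_vf_S7_frame[of "frame_index j"] unfolding smooth_vf_def
      by (intro bounded_bilinear.Ck_manifold[OF bounded_bilinear_inner]) auto
    then show "Ck_manifold \<infinity> S7 (\<lambda>p. (\<chi> i j. sphere_frame j p \<bullet> V i p) $ i $ j)" by simp
  qed
qed

text \<open>This contains the independence of the splitting. \<open>B\<close> gives the
  \<open>e i\<close> in coordinates orthonormal for the split inner product, so its determinant is 1
  or -1; \<open>A\<close> gives them in the frame. The two differ by \<open>T\<close>, whose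
  determinant is the diagonal entry \<open>1 / sqrt 24\<close>, whatever \<open>P\<close> does to
  the first frame vector.\<close>

lemma abs_frame_det_split_orthonormal:
  fixes e :: "7 \<Rightarrow> real ^ 8"
  assumes p: "p \<in> S7" and P: "splitting S7 contact_distribution p P"
    and e: "\<And>i. e i \<in> tangent_space S7 p"
    and orth: "\<And>i j. split_inner S7 contact_distribution P p (e i) (e j) = (if i = j then 1 else 0)"
  shows "\<bar>det (\<chi> i j. sphere_frame j p \<bullet> e i)\<bar> = sqrt 24"
proof -
  obtain k where k: "frame_index k = 1"
    using frame_index_1 by blast
  let ?E = "\<lambda>j. sphere_frame j p"
  have Ek: "S7_frame 1 p = ?E k"
    using k by simp
  have "linear P" and P_H: "\<And>v. v \<in> tangent_space S7 p \<Longrightarrow> P v \<in> contact_distribution p"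
    and P_id: "\<And>v. v \<in> contact_distribution p \<Longrightarrow> P v = v"
    using P by (auto simp: splitting_def)
  define A :: "real^7^7" where "A = (\<chi> i j. ?E j \<bullet> e i)"
  define B :: "real^7^7" where "B = (\<chi> i j. if j = k then (?E k \<bullet> e i) / sqrt 24 else ?E j \<bullet> P (e i))"
  \<comment> \<open>The split coordinates of the first frame vector: \<open>1 / sqrt 24\<close> in
    the quotient and the horizontal part that \<open>P\<close> assigns to it.\<close>
  define t :: "real^7" where "t = (\<chi> j. if j = k then 1 / sqrt 24 else ?E j \<bullet> P (?E k))"
  define T :: "real^7^7" where "T = (\<chi> i. if i = k then t else axis i 1)"
  have "(B ** transpose B) $ i $ j = (if i = j then 1 else 0)" for i j
  proof -
    have PH: "P (e i) \<in> contact_distribution p" for i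
      using e by (rule P_H)
    have Pk: "?E k \<bullet> P (e i) = 0" for i
      using PH[of i] mem_contact_distribution[OF p] Ek by simp
    have PT: "P (e i) \<in> tangent_space S7 p" for i
      using PH contact_distribution_tangent by blast
    have "P (e i) \<bullet> P (e j) = (\<Sum>l\<in>UNIV. (?E l \<bullet> P (e i)) * (?E l \<bullet> P (e j)))"
      by (subst sphere_frame_expansion[OF p PT, of i]) (simp add: inner_sum_left)
    \<comment> \<open>Horizontal vectors have no component with index \<open>k\<close>, which leaves
      this slot of \<open>B\<close> free for the quotient coordinate.\<close>
    also have "\<dots> = (\<Sum>l\<in>UNIV - {k}. (?E l \<bullet> P (e i)) * (?E l \<bullet> P (e j)))"
      by (subst sum.remove[of _ k]) (simp_all add: Pk)
    also have "\<dots> = (\<Sum>l\<in>UNIV - {k}. B $ i $ l * B $ j $ l)"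
      by (intro sum.cong) (auto simp: B_def)
    finally have "(\<Sum>l\<in>UNIV. B $ i $ l * B $ j $ l)
        = P (e i) \<bullet> P (e j) + (?E k \<bullet> e i) * (?E k \<bullet> e j) / 24"
      by (subst sum.remove[of _ k]) (simp_all add: B_def)
    also have "\<dots> = (if i = j then 1 else 0)"
      using orth[of i j] unfolding split_inner_def quotient_inner_contact[OF p e e] Ek .
    finally show ?thesis
      by (simp add: matrix_matrix_mult_def transpose_def)
  qed
  then have "B ** transpose B = mat 1"
    by (simp add: vec_eq_iff mat_def)
  then have "det B * det B = 1"
    by (metis det_I det_mul det_transpose)
  moreover have "B = A ** T"
  proof -
    have "(A ** T) $ i $ j = B $ i $ j" for i j
    proof -
      have "(A ** T) $ i $ j = A $ i $ k * t $ j + (\<Sum>l\<in>UNIV - {k}. A $ i $ l * axis l 1 $ j)"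
        unfolding matrix_matrix_mult_def T_def by (simp, subst sum.remove[of _ k]) simp_all
      also have "(\<Sum>l\<in>UNIV - {k}. A $ i $ l * axis l 1 $ j) = (\<Sum>l\<in>UNIV - {k}. if l = j then A $ i $ j else 0)"
        by (intro sum.cong) (auto simp: axis_def)
      also have "\<dots> = (if j = k then 0 else A $ i $ j)"
        by (simp add: sum.delta)
      also have "A $ i $ k * t $ j + \<dots> = B $ i $ j"
      proof (cases "j = k")
        case True
        then show ?thesis by (simp add: A_def B_def t_def)
      next
        case False
        \<comment> \<open>Without its component along \<open>?E k\<close> the vector is horizontal
          and fixed by \<open>P\<close>; hence \<open>P (e i)\<close> is determined by
          \<open>P (?E k)\<close>.\<close>
        have "e i - (?E k \<bullet> e i) *\<^sub>R ?E k \<in> contact_distribution p"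
          using e[of i] mem_tangent_space_S7[OF p] mem_contact_distribution[OF p] Ek
            sphere_frame_orthonormal[OF p, of k k]
          by (simp add: inner_diff_right S7_frame_inner_self)
        then have "P (e i - (?E k \<bullet> e i) *\<^sub>R ?E k) = e i - (?E k \<bullet> e i) *\<^sub>R ?E k"
          by (rule P_id)
        then have "P (e i) = (?E k \<bullet> e i) *\<^sub>R P (?E k) + (e i - (?E k \<bullet> e i) *\<^sub>R ?E k)"
          using \<open>linear P\<close> by (simp add: linear_diff linear_scale algebra_simps)
        then have "?E j \<bullet> P (e i) = (?E k \<bullet> e i) * (?E j \<bullet> P (?E k)) + ?E j \<bullet> e i"
          using False sphere_frame_orthonormal[OF p, of j k] by (simp add: inner_add_right inner_diff_right)
        then show ?thesis
          using False by (simp add: A_def B_def t_def)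
      qed
      finally show ?thesis .
    qed
    then show ?thesis
      by (simp add: vec_eq_iff)
  qed
  moreover have "det T = 1 / sqrt 24"
    unfolding T_def det_replace_row_mat_1 by (simp add: t_def)
  ultimately have "(det A)\<^sup>2 = 24"
    by (simp add: det_mul power2_eq_square)
  then show ?thesis
    unfolding A_def by (metis real_sqrt_abs)
qed

lemma popp_volume_form_exists:
  "popp_volume_form S7 contact_distribution
    (\<lambda>p (e :: 7 \<Rightarrow> real ^ 8). 1 / sqrt 24 * det (\<chi> i j. sphere_frame j p \<bullet> e i))"
  unfolding popp_volume_form_def
proof (intro conjI ballI allI impI)
  fix p :: "real ^ 8" assume p: "p \<in> S7"
  then have "p \<noteq> 0" by auto
  then show "dim (tangent_space S7 p) = CARD(7)"
    using p by (simp add: tangent_space_S7 dim_hyperplane del: mem_sphere_0)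
  fix P and e :: "7 \<Rightarrow> real ^ 8"
  assume "splitting S7 contact_distribution p P \<and> (\<forall>i. e i \<in> tangent_space S7 p) \<and>
    (\<forall>i j. split_inner S7 contact_distribution P p (e i) (e j) = (if i = j then 1 else 0))"
  then show "\<bar>1 / sqrt 24 * det (\<chi> i j. sphere_frame j p \<bullet> e i)\<bar> = 1"
    using abs_frame_det_split_orthonormal[OF p, of P e] by (simp add: abs_mult)
qed (rule step_two_contact smooth_form_frame_det)+

section \<open>The intrinsic sub-Laplacian\<close>

lemma horizontal_gradient_contact:
  assumes p: "p \<in> S7" and f: "(f has_derivative D) (at p within S7)"
  shows "horizontal_gradient S7 contact_distribution f p
    = (\<Sum>a = 2..7. vf_apply S7 (S7_frame a) f p *\<^sub>R S7_frame a p)" (is "_ = ?v")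
  unfolding horizontal_gradient_def
proof (rule the_equality)
  let ?H = "contact_distribution p"
  have H: "subspace ?H"
    using p by (rule subspace_contact_distribution)
  have v: "?v \<in> ?H"
    using p H by (intro subspace_sum subspace_scale frame_mem_contact_distribution)
  have D: "mdiff S7 f p w = D w" if "w \<in> ?H" for w
    using f that contact_distribution_tangent by (intro mdiff_eq) auto
  have vw: "?v \<bullet> w = mdiff S7 f p w" if w: "w \<in> ?H" for w
  proof -
    have "D w = D (\<Sum>a = 2..7. (S7_frame a p \<bullet> w) *\<^sub>R S7_frame a p)"
      using contact_expansion[OF p w] by (rule arg_cong)
    also have "\<dots> = (\<Sum>a = 2..7. (S7_frame a p \<bullet> w) * D (S7_frame a p))"
      using has_derivative_linear[OF f] by (simp add: linear_sum linear_scale)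
    also have "\<dots> = ?v \<bullet> w"
      using D frame_mem_contact_distribution[OF p]
      by (simp add: inner_sum_left vf_apply_def mult.commute)
    finally show ?thesis using D[OF w] by simp
  qed
  with v show "?v \<in> ?H \<and> (\<forall>w\<in>?H. ?v \<bullet> w = mdiff S7 f p w)"
    by blast
  fix u assume u: "u \<in> ?H \<and> (\<forall>w\<in>?H. u \<bullet> w = mdiff S7 f p w)"
  then have "u - ?v \<in> ?H"
    using H v by (simp add: subspace_diff)
  then have "(u - ?v) \<bullet> (u - ?v) = 0"
    using u vw by (subst inner_diff_left) simp
  then show "u = ?v" by simp
qed

lemma sub_laplacian_contact:
  fixes \<mu> :: "real ^ 8 \<Rightarrow> (7 \<Rightarrow> real ^ 8) \<Rightarrow> real"
  assumes \<mu>: "popp_volume_form S7 contact_distribution \<mu>" and f: "Ck_manifold 2 S7 f" and p: "p \<in> S7"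
  shows "sub_laplacian S7 contact_distribution \<mu> f p
    = (\<Sum>a = 2..7. vf_apply S7 (S7_frame a) (vf_apply S7 (S7_frame a) f) p)"
proof -
  have frame_tan: "S7_frame a q \<in> tangent_space S7 q" if "q \<in> S7" for a q
    using mem_tangent_space_S7[OF that] by (simp add: S7_frame_inner_self)
  have "\<forall>a. \<exists>D. (vf_apply S7 (S7_frame a) f has_derivative D) (at p within S7)"
    using Ck_manifold_2_has_derivative_along[OF f p bounded_linear_S7_frame frame_tan] by metis
  then obtain D where D: "\<And>a. (vf_apply S7 (S7_frame a) f has_derivative D a) (at p within S7)"
    by metis
  \<comment> \<open>The zero at index 1 extends the horizontal gradient to the sum over the full
    frame that \<open>divergence_sphere_frame\<close> expects.\<close>
  define u where "u a = (if a = 1 then (\<lambda>_. 0) else vf_apply S7 (S7_frame a) f)" for a :: nat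
  define u' where "u' a = (if a = 1 then (\<lambda>_. 0) else D a)" for a :: nat
  have drop1: "(\<Sum>a = 1..7. h a) = (\<Sum>a = 2..7. h a)" if "h 1 = 0" for h :: "nat \<Rightarrow> 'b::comm_monoid_add"
  proof -
    have "{1..7::nat} = insert 1 {2..7}" by auto
    then show ?thesis using that by simp
  qed
  have "divergence S7 \<mu> (horizontal_gradient S7 contact_distribution f) p
      = (\<Sum>i\<in>UNIV. u' (frame_index i) (sphere_frame i p))"
  proof (rule divergence_sphere_frame)
    show "smooth_form S7 \<mu>"
      using \<mu> by (simp add: popp_volume_form_def)
    show "(\<mu> q (\<lambda>i. sphere_frame i q))\<^sup>2 = 1 / 24" if "q \<in> S7" for q
      using \<mu> that by (rule popp_frame_square)
    show "(u (frame_index i) has_derivative u' (frame_index i)) (at p within S7)" for i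
      using D by (simp add: u_def u'_def)
    show "horizontal_gradient S7 contact_distribution f q
        = (\<Sum>i\<in>UNIV. u (frame_index i) q *\<^sub>R sphere_frame i q)" if q: "q \<in> S7" for q
    proof -
      obtain A where "(f has_derivative A) (at q within S7)"
        by (rule Ck_manifold_has_derivative[OF f _ q]) auto
      from horizontal_gradient_contact[OF q this]
      have "horizontal_gradient S7 contact_distribution f q = (\<Sum>a = 2..7. u a q *\<^sub>R S7_frame a q)"
        by (simp add: u_def)
      also have "\<dots> = (\<Sum>a = 1..7. u a q *\<^sub>R S7_frame a q)"
        by (rule drop1[symmetric]) (simp add: u_def)
      also have "\<dots> = (\<Sum>i\<in>UNIV. u (frame_index i) q *\<^sub>R sphere_frame i q)"
        by (rule sum_frame_index[symmetric])
      finally show ?thesis .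
    qed
  qed (use p in simp_all)
  also have "\<dots> = (\<Sum>a = 2..7. u' a (S7_frame a p))"
    unfolding sum_frame_index[of "\<lambda>a. u' a (S7_frame a p)"] by (rule drop1) (simp add: u'_def)
  also have "\<dots> = (\<Sum>a = 2..7. vf_apply S7 (S7_frame a) (vf_apply S7 (S7_frame a) f) p)"
    using mdiff_eq[OF D frame_tan[OF p]]
    by (intro sum.cong) (auto simp: u'_def vf_apply_def[of S7 _ "vf_apply S7 _ f"])
  finally show ?thesis
    by (simp add: sub_laplacian_def)
qed

theorem theorem4:
  "(\<exists>\<mu> :: real ^ 8 \<Rightarrow> (7 \<Rightarrow> real ^ 8) \<Rightarrow> real. popp_volume_form S7 contact_distribution \<mu>) \<and>
   (\<forall>\<mu> :: real ^ 8 \<Rightarrow> (7 \<Rightarrow> real ^ 8) \<Rightarrow> real. popp_volume_form S7 contact_distribution \<mu> \<longrightarrow>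
      (\<forall>f :: real ^ 8 \<Rightarrow> real. Ck_manifold 2 S7 f \<longrightarrow>
         (\<forall>p\<in>S7. sub_laplacian S7 contact_distribution \<mu> f p =
            (\<Sum>a = 2..7. vf_apply S7 (S7_frame a) (vf_apply S7 (S7_frame a) f) p))))"
  using popp_volume_form_exists sub_laplacian_contact by blast

end
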